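(* Let $\alpha$ be any irrational real number, with Diophantine type $\beta=\beta(\alpha)$, and let $l,u$ be any real numbers with $0\le l<u\le 1$ and $u>1/\beta$. Then there exists a function $\varphi:\mathbb N\to\mathbb R^+$ decreasing to zero, with $l_\varphi=l$ and $u_\varphi=u$, such that $$\dim_H\big(E_\varphi(\alpha)\big)=\max\left\{l,\ \frac{1+u}{1+\beta}\right\}<u .$$
   Context: $\|x\|$ denotes the distance from $x\in\mathbb R$ to the nearest integer, $\mathbb N$ is the set of positive integers, $\mathbb R^+$ the set of positive reals, and $\dim_H$ is Hausdorff dimension. "Decreasing" is understood in the weak sense (non-increasing). The Diophantine type of an irrational $\alpha$ is $\beta(\alpha):=\sup\{\theta\ge 1:\liminf_{n\to\infty} n^\theta\|n\alpha\|=0\}\in[1,\infty]$ (equal to $1$ if the set is empty; if $\beta=\infty$, then $1/\beta$ and $\frac{1+u}{1+\beta}$ are read as $0$). For $\varphi:\mathbb N\to\mathbb R^+$ decreasing to zero, $$E_\varphi(\alpha):=\{y\in\mathbb R:\ \|n\alpha-y\|<\varphi(n)\text{ for infinitely many } n\in\mathbb N\},$$ $$u_\varphi:=\limsup_{n\to\infty}\frac{\log n}{-\log\varphi(n)},\qquad l_\varphi:=\liminf_{n\to\infty}\frac{\log n}{-\log\varphi(n)}.$$ *)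

theory Defs
  imports "HOL-Analysis.Analysis"
begin

section \<open>Hausdorff measure and dimension\<close>

text \<open>
  The term \<open>(diam U)\<^sup>s\<close> of a covering set, with the usual conventions that the empty set
  contributes \<open>0\<close> and that a nonempty set contributes \<open>1\<close> for \<open>s = 0\<close>. The case \<open>s = 0\<close> is
  separate because \<open>0 powr 0 = 0\<close> in HOL.
\<close>

definition hausdorff_gauge :: "real \<Rightarrow> 'a::metric_space set \<Rightarrow> real" where
  "hausdorff_gauge s U = (if U = {} then 0 else if s = 0 then 1 else diameter U powr s)"

text \<open>
  Boundedness of the covering sets is demanded explicitly because \<^const>\<open>diameter\<close> is
  real-valued and unspecified on unbounded sets. Finite covers are included, since members of
  the sequence may be empty.
\<close>

definition hausdorff_premeasure :: "real \<Rightarrow> real \<Rightarrow> 'a::metric_space set \<Rightarrow> ennreal" where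
  "hausdorff_premeasure \<delta> s S =
     (INF U \<in> {U :: nat \<Rightarrow> 'a set. S \<subseteq> (\<Union>i. U i) \<and> (\<forall>i. bounded (U i) \<and> diameter (U i) \<le> \<delta>)}.
        \<Sum>i. ennreal (hausdorff_gauge s (U i)))"

definition hausdorff_measure :: "real \<Rightarrow> 'a::metric_space set \<Rightarrow> ennreal" where
  "hausdorff_measure s S = (SUP \<delta> \<in> {0<..}. hausdorff_premeasure \<delta> s S)"

definition hausdorff_dim :: "'a::metric_space set \<Rightarrow> ereal" where
  "hausdorff_dim S = Inf {ereal s | s. 0 \<le> s \<and> hausdorff_measure s S = 0}"

section \<open>Inhomogeneous Diophantine approximation\<close>

definition dist_nearest_int :: "real \<Rightarrow> real" where
  "dist_nearest_int x = infdist x \<int>"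

text \<open>
  Inserting \<open>1\<close> implements the convention that the type is \<open>1\<close> if no exponent qualifies;
  otherwise it does not affect the supremum, as all exponents are at least \<open>1\<close>.
\<close>

definition diophantine_type :: "real \<Rightarrow> ereal" where
  "diophantine_type \<alpha> = Sup (insert 1 {ereal \<theta> | \<theta>. 1 \<le> \<theta> \<and>
     liminf (\<lambda>n. ereal (real n powr \<theta> * dist_nearest_int (real n * \<alpha>))) = 0})"

text \<open>
  Approximation functions live on the positive integers; the value of \<open>\<phi>\<close> at \<open>0\<close> is irrelevant
  throughout.
\<close>

definition decreasing_to_zero :: "(nat \<Rightarrow> real) \<Rightarrow> bool" where
  "decreasing_to_zero \<phi> \<longleftrightarrow>
     (\<forall>n\<ge>1. 0 < \<phi> n) \<and> (\<forall>m n. 1 \<le> m \<and> m \<le> n \<longrightarrow> \<phi> n \<le> \<phi> m) \<and> \<phi> \<longlonglongrightarrow> 0"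

definition inhom_approx_set :: "(nat \<Rightarrow> real) \<Rightarrow> real \<Rightarrow> real set" where
  "inhom_approx_set \<phi> \<alpha> = {y. infinite {n. 1 \<le> n \<and> dist_nearest_int (real n * \<alpha> - y) < \<phi> n}}"

definition upper_order :: "(nat \<Rightarrow> real) \<Rightarrow> ereal" where
  "upper_order \<phi> = limsup (\<lambda>n. ereal (ln (real n) / - ln (\<phi> n)))"

definition lower_order :: "(nat \<Rightarrow> real) \<Rightarrow> ereal" where
  "lower_order \<phi> = liminf (\<lambda>n. ereal (ln (real n) / - ln (\<phi> n)))"

end

theory Submission
  imports Defs "HOL-Number_Theory.Cong" "HOL-Real_Asymp.Real_Asymp"
begin

text \<open>
  Let \<open>\<beta>\<close> be the type of \<open>\<alpha>\<close> and \<open>S = (1 + u) / (1 + \<beta>)\<close>, which is less than \<open>u\<close> because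
  \<open>u > 1 / \<beta>\<close>. Take a base function \<open>\<psi>\<close> of order \<open>l\<close>, such as \<open>\<psi> n = n powr (- 1 / l)\<close>, and a very
  sparse sequence of reduced fractions \<open>p / q\<close> for which \<open>\<epsilon> = \<bar>\<alpha> - p / q\<bar>\<close> is nearly as small as \<open>\<beta>\<close>
  permits. Put \<open>r = \<epsilon> powr (1 / (1 + u))\<close> and \<open>N \<approx> r powr (- u)\<close>, so that \<open>N * \<epsilon> \<approx> r\<close>, and let \<open>\<phi>\<close>
  be \<open>\<psi>\<close> raised to the constant \<open>r\<close> up to \<open>N\<close>, for each of the fractions. Then \<open>\<phi>\<close> has order \<open>u\<close> at
  \<open>n = N\<close>, and order \<open>l\<close> just after \<open>N\<close>, where the next radius does not exceed \<open>\<psi>\<close>.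

  Upper bound. The points approximated infinitely often within \<open>\<psi> n\<close> form a set of dimension at
  most \<open>l\<close>. For \<open>n \<le> N\<close> the point \<open>n\<alpha>\<close> differs from \<open>np / q\<close> by at most \<open>N * \<epsilon> \<le> r\<close>, so modulo \<open>1\<close> the \<open>N\<close>
  intervals of radius \<open>r\<close> are contained in just \<open>q\<close> intervals of radius \<open>2 * r\<close>. Since
  \<open>q \<approx> r powr (- S)\<close>, their contribution has dimension at most \<open>S\<close>. This is lemma
  \<open>hausdorff_measure_inhom_approx_set_\<phi>\<close>. The choice of \<open>r\<close> balances the radius of the
  intervals against the length of the clusters that the multiples of \<open>\<alpha>\<close> form around the
  fractions with denominator \<open>q\<close>.

  Lower bound. If \<open>\<phi> (2 * q) \<ge> q powr (- 1 / t)\<close> for arbitrarily large reduced approximations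
  with \<open>\<bar>\<alpha> - p / q\<bar> < 1 / q\<^sup>2\<close>, then the dimension is at least \<open>t\<close>
  (\<open>hausdorff_measure_inhom_approx_set_nonzero\<close>), because the points \<open>n\<alpha>\<close> with \<open>q \<le> n < 2 * q\<close> are
  evenly spread at scale \<open>1 / q\<close>. The condition holds for every \<open>t < l\<close> as \<open>\<phi> \<ge> \<psi>\<close>, and for every
  \<open>t < S\<close> along all but finitely many of the chosen fractions, where \<open>2 * q \<le> N\<close> and \<open>r \<ge> q powr (- 1 / t)\<close> by the
  definition of the type. Instead of a measure on a Cantor set, the proof uses the cover
  itself: given a cover of small total cost, it selects nested intervals, each meeting only
  members of the cover that are cheap compared with its own length
  (\<open>exists_piece_of_small_cost\<close>), and so reaches a point of the set that is not covered.
\<close>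

section \<open>Sets of Hausdorff measure zero\<close>

lemma hausdorff_gauge_pos_exponent:
  assumes "s > 0"
  shows "hausdorff_gauge s U = diameter U powr s"
  using assms by (simp add: hausdorff_gauge_def)

lemma ennreal_le_suminf:
  fixes f :: "nat \<Rightarrow> ennreal"
  shows "f i \<le> (\<Sum>i. f i)"
  using sum_le_suminf[of f "{i}", OF summableI] by simp

text \<open>
  For a positive exponent the bound on the diameters is redundant when testing for measure zero:
  if the total cost of a cover is below \<open>\<delta> powr s\<close>, then every member has diameter below \<open>\<delta>\<close>.
\<close>

lemma hausdorff_measure_eq_0I:
  fixes S :: "'a::metric_space set"
  assumes s: "s > 0"
    and cover: "\<And>e. e > 0 \<Longrightarrow> \<exists>U :: nat \<Rightarrow> 'a set. S \<subseteq> (\<Union>i. U i) \<and> (\<forall>i. bounded (U i))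
                  \<and> (\<Sum>i. ennreal (diameter (U i) powr s)) < ennreal e"
  shows "hausdorff_measure s S = 0"
proof -
  have main: "hausdorff_premeasure \<delta> s S \<le> 0 + ennreal e" if \<delta>: "\<delta> > 0" and e: "e > 0" for \<delta> e
  proof -
    define e' where "e' = min e (\<delta> powr s)"
    have "e' > 0" using e \<delta> by (simp add: e'_def)
    from cover[OF this] obtain U :: "nat \<Rightarrow> 'a set"
      where *: "S \<subseteq> (\<Union>i. U i) \<and> (\<forall>i. bounded (U i))
        \<and> (\<Sum>i. ennreal (diameter (U i) powr s)) < ennreal e'"
      by (rule exE)
    then have U: "S \<subseteq> (\<Union>i. U i)" "\<And>i. bounded (U i)"
      and sum: "(\<Sum>i. ennreal (diameter (U i) powr s)) < ennreal e'"
      by simp_all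
    have "diameter (U i) \<le> \<delta>" for i
    proof (rule ccontr)
      assume "\<not> diameter (U i) \<le> \<delta>"
      then have "\<delta> powr s \<le> diameter (U i) powr s"
        using s \<delta> by (intro powr_mono2) simp_all
      then have "ennreal e' \<le> ennreal (diameter (U i) powr s)"
        by (intro ennreal_leI) (simp add: e'_def)
      also have "\<dots> \<le> (\<Sum>i. ennreal (diameter (U i) powr s))"
        by (rule ennreal_le_suminf)
      finally have "ennreal e' \<le> (\<Sum>i. ennreal (diameter (U i) powr s))" .
      from leD[OF this] sum show False by (rule notE)
    qed
    then have "hausdorff_premeasure \<delta> s S \<le> (\<Sum>i. ennreal (hausdorff_gauge s (U i)))"
      unfolding hausdorff_premeasure_def using U by (intro INF_lower CollectI conjI allI)
    also have "\<dots> \<le> ennreal e'"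
      using less_imp_le[OF sum] s by (simp add: hausdorff_gauge_pos_exponent)
    also have "\<dots> \<le> ennreal e"
      by (simp add: e'_def ennreal_leI)
    finally show ?thesis by (simp only: add_0)
  qed
  have "hausdorff_premeasure \<delta> s S \<le> 0" if "\<delta> > 0" for \<delta>
  proof (rule ennreal_le_epsilon)
    fix e :: real assume "e > 0"
    with main[OF that] show "hausdorff_premeasure \<delta> s S \<le> 0 + ennreal e" .
  qed
  then have "hausdorff_measure s S \<le> 0"
    unfolding hausdorff_measure_def by (intro SUP_least) simp
  then show ?thesis by (simp only: le_zero_eq)
qed

lemma hausdorff_measure_eq_0D:
  fixes S :: "'a::metric_space set"
  assumes s: "s > 0" and "hausdorff_measure s S = 0" and "e > 0"
  shows "\<exists>U :: nat \<Rightarrow> 'a set. S \<subseteq> (\<Union>i. U i) \<and> (\<forall>i. bounded (U i))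
           \<and> (\<Sum>i. ennreal (diameter (U i) powr s)) < ennreal e"
proof -
  have "hausdorff_premeasure 1 s S \<le> hausdorff_measure s S"
    unfolding hausdorff_measure_def by (rule SUP_upper) simp
  then have "hausdorff_premeasure 1 s S < ennreal e"
    using assms by simp
  then obtain U :: "nat \<Rightarrow> 'a set" where
    "U \<in> {U. S \<subseteq> (\<Union>i. U i) \<and> (\<forall>i. bounded (U i) \<and> diameter (U i) \<le> 1)}"
    "(\<Sum>i. ennreal (hausdorff_gauge s (U i))) < ennreal e"
    unfolding hausdorff_premeasure_def INF_less_iff by (rule bexE)
  then show ?thesis
    using s by (intro exI[of _ U]) (simp add: hausdorff_gauge_pos_exponent)
qed

lemma hausdorff_measure_UN_eq_0:
  fixes S :: "nat \<Rightarrow> 'a::metric_space set"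
  assumes s: "s > 0" and null: "\<And>n. hausdorff_measure s (S n) = 0"
  shows "hausdorff_measure s (\<Union>n. S n) = 0"
proof (rule hausdorff_measure_eq_0I[OF s])
  fix e :: real assume e: "e > 0"
  have "\<exists>U :: nat \<Rightarrow> 'a set. S n \<subseteq> (\<Union>i. U i) \<and> (\<forall>i. bounded (U i)) \<and>
      (\<Sum>i. ennreal (diameter (U i) powr s)) < ennreal (e / 2 * (1/2) ^ Suc n)" for n
  proof -
    have "e / 2 * (1/2) ^ Suc n > 0" using e by simp
    from hausdorff_measure_eq_0D[OF s null[of n] this] show ?thesis .
  qed
  then have "\<forall>n. \<exists>U :: nat \<Rightarrow> 'a set. S n \<subseteq> (\<Union>i. U i) \<and> (\<forall>i. bounded (U i)) \<and>
      (\<Sum>i. ennreal (diameter (U i) powr s)) < ennreal (e / 2 * (1/2) ^ Suc n)"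
    by (rule allI)
  from choice[OF this] obtain U :: "nat \<Rightarrow> nat \<Rightarrow> 'a set" where
    U': "\<forall>n. S n \<subseteq> (\<Union>i. U n i) \<and> (\<forall>i. bounded (U n i)) \<and>
      (\<Sum>i. ennreal (diameter (U n i) powr s)) < ennreal (e / 2 * (1/2) ^ Suc n)"
    by (rule exE)
  then have U: "\<And>n. S n \<subseteq> (\<Union>i. U n i)" "\<And>n i. bounded (U n i)"
      "\<And>n. (\<Sum>i. ennreal (diameter (U n i) powr s)) < ennreal (e / 2 * (1/2) ^ Suc n)"
    by simp_all
  define V where "V = (\<lambda>i. case prod_decode i of (n, k) \<Rightarrow> U n k)"
  have "(\<Sum>i. ennreal (diameter (V i) powr s))
      = (\<Sum>i. (\<lambda>(n, k). ennreal (diameter (U n k) powr s)) (prod_decode i))"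
    by (simp add: V_def case_prod_unfold)
  also have "\<dots> = (\<Sum>n. \<Sum>i. ennreal (diameter (U n i) powr s))"
    by (rule suminf_ennreal_2dimen) simp
  also have "\<dots> \<le> (\<Sum>n. ennreal (e / 2 * (1/2) ^ Suc n))"
    using less_imp_le[OF U(3)] by (intro suminf_le summableI)
  also have "\<dots> = ennreal (e / 2)"
    using sums_mult[OF power_half_series, of "e / 2"] e
    by (intro suminf_ennreal_eq) auto
  also have "\<dots> < ennreal e" using e by (simp add: ennreal_less_iff)
  finally have "(\<Sum>i. ennreal (diameter (V i) powr s)) < ennreal e" .
  moreover have "(\<Union>n. S n) \<subseteq> (\<Union>i. V i)"
  proof
    fix x assume "x \<in> (\<Union>n. S n)"
    then obtain n k where "x \<in> U n k" using U(1) by blast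
    then have "x \<in> V (prod_encode (n, k))" by (simp add: V_def)
    then show "x \<in> (\<Union>i. V i)" by blast
  qed
  moreover have "\<forall>i. bounded (V i)"
    using U(2) by (simp add: V_def case_prod_unfold)
  ultimately show "\<exists>V. (\<Union>n. S n) \<subseteq> (\<Union>i. V i) \<and> (\<forall>i. bounded (V i))
      \<and> (\<Sum>i. ennreal (diameter (V i) powr s)) < ennreal e"
    by (intro exI[of _ V] conjI)
qed

lemma hausdorff_measure_mono:
  fixes S T :: "'a::metric_space set"
  assumes "S \<subseteq> T"
  shows "hausdorff_measure s S \<le> hausdorff_measure s T"
proof -
  have "hausdorff_premeasure \<delta> s S \<le> hausdorff_premeasure \<delta> s T" for \<delta>
    unfolding hausdorff_premeasure_def
  proof (rule INF_superset_mono[OF _ order_refl], rule Collect_mono, rule impI)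
    fix U :: "nat \<Rightarrow> 'a set"
    assume "T \<subseteq> (\<Union>i. U i) \<and> (\<forall>i. bounded (U i) \<and> diameter (U i) \<le> \<delta>)"
    then show "S \<subseteq> (\<Union>i. U i) \<and> (\<forall>i. bounded (U i) \<and> diameter (U i) \<le> \<delta>)"
      using assms by (simp add: order_trans[OF assms])
  qed
  then show ?thesis
    unfolding hausdorff_measure_def by (intro SUP_mono')
qed

text \<open>
  The convergence part of the Borel--Cantelli argument, for points that are infinitely often close
  to a translate \<open>x n + \<int> / q n\<close>: a bounded interval meets \<open>O(q n)\<close> of the balls of radius
  \<open>\<rho> n\<close>.
\<close>

lemma hausdorff_measure_limsup_eq_0:
  fixes x \<rho> :: "nat \<Rightarrow> real" and q :: "nat \<Rightarrow> nat"
  assumes s: "s > 0" and q: "\<And>n. q n \<ge> 1" and \<rho>: "\<And>n. \<rho> n \<ge> 0" and \<rho>0: "\<rho> \<longlonglongrightarrow> 0"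
    and summ: "summable (\<lambda>n. real (q n) * \<rho> n powr s)"
  shows "hausdorff_measure s {y. infinite {n. \<exists>m::int. \<bar>y - (x n + m / q n)\<bar> < \<rho> n}} = 0"
    (is "hausdorff_measure s ?S = 0")
proof -
  have "hausdorff_measure s (?S \<inter> {- real M..real M}) = 0" for M :: nat
  proof (rule hausdorff_measure_eq_0I[OF s])
    fix e :: real assume e: "e > 0"
    define C where "C = real (2 * M + 3) * 2 powr s"
    have C: "C > 0" by (simp add: C_def add_pos_nonneg)
    let ?f = "\<lambda>n. real (q n) * \<rho> n powr s"
    have "(\<lambda>n. \<Sum>i. ?f (i + n)) \<longlonglongrightarrow> 0"
      using suminf_exist_split2[OF summ] .
    then have "\<forall>\<^sub>F n in sequentially. (\<Sum>i. ?f (i + n)) < e / C"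
      using e C by (intro order_tendstoD(2)[of _ 0]) auto
    moreover have "\<forall>\<^sub>F n in sequentially. \<forall>m\<ge>n. \<rho> m < 1"
      using order_tendstoD(2)[OF \<rho>0, of 1] eventually_all_ge_at_top by fastforce
    ultimately have "\<forall>\<^sub>F n in sequentially. (\<Sum>i. ?f (i + n)) < e / C \<and> (\<forall>m\<ge>n. \<rho> m < 1)"
      by (rule eventually_conj)
    then obtain n0 where tail: "(\<Sum>i. ?f (i + n0)) < e / C" and \<rho>1: "\<And>m. m \<ge> n0 \<Longrightarrow> \<rho> m < 1"
      by (auto simp: eventually_sequentially)
    \<comment> \<open>The relevant integers \<open>m\<close> are \<open>b n + k\<close> with \<open>k < K n\<close>, for which the centre has modulus at
      most about \<open>M + 1\<close>.\<close>
    define b where "b = (\<lambda>n. \<lceil>real (q n) * (- real M - 1 - x n)\<rceil>)"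
    define K where "K = (\<lambda>n. q n * (2 * M + 2) + 1)"
    define c where "c = (\<lambda>n k. x n + real_of_int (b n + int k) / q n)"
    define U where "U = (\<lambda>n k. if k < K n then {c n k - \<rho> n..c n k + \<rho> n} else {})"
    define V where "V = (\<lambda>i. case prod_decode i of (n, k) \<Rightarrow> U (n + n0) k)"
    have sumU: "(\<Sum>k. ennreal (diameter (U n k) powr s)) \<le> ennreal (C * ?f n)" for n
    proof -
      have "(\<Sum>k. ennreal (diameter (U n k) powr s)) = (\<Sum>k<K n. ennreal (diameter (U n k) powr s))"
        using s by (intro suminf_finite) (auto simp: U_def)
      also have "\<dots> = (\<Sum>k<K n. ennreal ((2 * \<rho> n) powr s))"
        using \<rho>[of n] by (intro sum.cong) (auto simp: U_def)
      also have "\<dots> = ennreal (real (K n) * (2 powr s * \<rho> n powr s))"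
        using \<rho>[of n] by (simp add: powr_mult ennreal_mult' ennreal_of_nat_eq_real_of_nat)
      also have "\<dots> \<le> ennreal (C * ?f n)"
      proof (rule ennreal_leI)
        have "K n \<le> q n * (2 * M + 3)"
          using q[of n] by (simp add: K_def algebra_simps)
        then have "real (K n) \<le> real (q n) * real (2 * M + 3)"
          by (metis of_nat_mono of_nat_mult)
        then have "real (K n) * (2 powr s * \<rho> n powr s)
            \<le> (real (q n) * real (2 * M + 3)) * (2 powr s * \<rho> n powr s)"
          by (intro mult_right_mono) auto
        then show "real (K n) * (2 powr s * \<rho> n powr s) \<le> C * ?f n"
          by (simp add: C_def mult_ac)
      qed
      finally show ?thesis .
    qed
    have "(\<Sum>i. ennreal (diameter (V i) powr s))
        = (\<Sum>i. (\<lambda>(n, k). ennreal (diameter (U (n + n0) k) powr s)) (prod_decode i))"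
      by (simp add: V_def case_prod_unfold)
    also have "\<dots> = (\<Sum>n. \<Sum>k. ennreal (diameter (U (n + n0) k) powr s))"
      by (rule suminf_ennreal_2dimen) simp
    also have "\<dots> \<le> (\<Sum>n. ennreal (C * ?f (n + n0)))"
      using sumU by (intro suminf_le) auto
    also have "\<dots> = ennreal (C * (\<Sum>i. ?f (i + n0)))"
      using summable_ignore_initial_segment[OF summ, of n0] C
      by (intro suminf_ennreal_eq sums_mult summable_sums) auto
    also have "\<dots> < ennreal e"
      using tail C e by (intro ennreal_lessI) (auto simp: field_simps)
    finally have "(\<Sum>i. ennreal (diameter (V i) powr s)) < ennreal e" .
    moreover have "?S \<inter> {- real M..real M} \<subseteq> (\<Union>i. V i)"
    proof
      fix y assume "y \<in> ?S \<inter> {- real M..real M}"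
      then have inf: "infinite {n. \<exists>m::int. \<bar>y - (x n + m / q n)\<bar> < \<rho> n}" and y: "\<bar>y\<bar> \<le> real M"
        by auto
      from inf obtain n where n: "n \<ge> n0" "\<exists>m::int. \<bar>y - (x n + m / q n)\<bar> < \<rho> n"
        unfolding infinite_nat_iff_unbounded_le by blast
      then obtain m :: int where m: "\<bar>y - (x n + m / q n)\<bar> < \<rho> n" by blast
      have q0: "real (q n) > 0" using q[of n] by simp
      have close: "\<bar>y - (x n + m / q n)\<bar> < 1" using m \<rho>1[OF n(1)] by simp
      have "- real M - 1 - x n \<le> m / q n" "m / q n \<le> real M + 1 - x n"
        using close y by (auto simp: abs_le_iff abs_less_iff)
      then have lo: "real (q n) * (- real M - 1 - x n) \<le> m"
        and hi: "m \<le> real (q n) * (real M + 1 - x n)"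
        using q0 by (auto simp: field_simps)
      from lo have "b n \<le> m" by (simp add: b_def ceiling_le_iff)
      define k where "k = nat (m - b n)"
      have mk: "m = b n + int k" using \<open>b n \<le> m\<close> by (simp add: k_def)
      have "real_of_int (m - b n) \<le> real (q n) * (real M + 1 - x n) - real (q n) * (- real M - 1 - x n)"
        using hi le_of_int_ceiling[of "real (q n) * (- real M - 1 - x n)"]
        unfolding b_def of_int_diff by (rule diff_mono)
      also have "\<dots> = real (q n * (2 * M + 2))" by (simp add: algebra_simps)
      finally have "real k \<le> real (q n * (2 * M + 2))"
        using mk by simp
      then have "k < K n" unfolding K_def by linarith
      moreover have "c n k = x n + m / q n" by (simp add: c_def mk)
      ultimately have "y \<in> U n k" using m by (auto simp: U_def abs_less_iff)
      then have "y \<in> V (prod_encode (n - n0, k))" using n(1) by (simp add: V_def)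
      then show "y \<in> (\<Union>i. V i)" by blast
    qed
    moreover have "\<forall>i. bounded (V i)"
      by (simp add: V_def U_def case_prod_unfold)
    ultimately show "\<exists>V. ?S \<inter> {- real M..real M} \<subseteq> (\<Union>i. V i) \<and> (\<forall>i. bounded (V i))
        \<and> (\<Sum>i. ennreal (diameter (V i) powr s)) < ennreal e"
      by (intro exI[of _ V] conjI)
  qed
  then have "hausdorff_measure s (\<Union>M. ?S \<inter> {- real M..real M}) = 0"
    by (rule hausdorff_measure_UN_eq_0[OF s])
  moreover have "?S \<subseteq> (\<Union>M. ?S \<inter> {- real M..real M})"
  proof
    fix y assume "y \<in> ?S"
    moreover obtain M :: nat where "\<bar>y\<bar> \<le> real M" using real_arch_simple by blast
    ultimately have "y \<in> ?S \<inter> {- real M..real M}" by (auto simp: abs_le_iff)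
    then show "y \<in> (\<Union>M. ?S \<inter> {- real M..real M})" by blast
  qed
  ultimately have "hausdorff_measure s ?S \<le> 0"
    using hausdorff_measure_mono[of ?S "\<Union>M. ?S \<inter> {- real M..real M}" s] by (simp only:)
  then show ?thesis by (simp only: le_zero_eq)
qed

lemma hausdorff_dim_leI:
  assumes "0 \<le> b" and "\<And>s. s > b \<Longrightarrow> hausdorff_measure s S = 0"
  shows "hausdorff_dim S \<le> ereal b"
proof (rule ereal_le_epsilon2)
  fix e :: real assume "0 < e"
  then show "hausdorff_dim S \<le> ereal b + ereal e"
    unfolding hausdorff_dim_def plus_ereal.simps using assms
    by (intro Inf_lower CollectI exI[of _ "b + e"]) simp
qed

lemma hausdorff_dim_geI:
  fixes S :: "'a::metric_space set"
  assumes pos: "\<And>s. 0 < s \<Longrightarrow> s < b \<Longrightarrow> hausdorff_measure s S \<noteq> 0"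
  shows "ereal b \<le> hausdorff_dim S"
  unfolding hausdorff_dim_def
proof (rule Inf_greatest, clarify)
  fix s :: real assume s: "0 \<le> s" "hausdorff_measure s S = 0"
  show "ereal b \<le> ereal s"
  proof (rule ccontr)
    assume "\<not> ereal b \<le> ereal s"
    then have "s < b" by simp
    with pos s have "s = 0" by (metis less_eq_real_def)
    \<comment> \<open>The gauge of exponent \<open>0\<close> counts nonempty sets, so only the empty set is null.\<close>
    have "hausdorff_premeasure 1 0 S \<le> hausdorff_measure 0 S"
      unfolding hausdorff_measure_def by (rule SUP_upper) simp
    then have "hausdorff_premeasure 1 0 S < 1"
      using s \<open>s = 0\<close> by simp
    then obtain U :: "nat \<Rightarrow> 'a set" where
      U: "U \<in> {U. S \<subseteq> (\<Union>i. U i) \<and> (\<forall>i. bounded (U i) \<and> diameter (U i) \<le> 1)}"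
      and sum: "(\<Sum>i. ennreal (hausdorff_gauge 0 (U i))) < 1"
      unfolding hausdorff_premeasure_def INF_less_iff by (rule bexE)
    have "U i = {}" for i
    proof (rule ccontr)
      assume "U i \<noteq> {}"
      then have "1 = ennreal (hausdorff_gauge 0 (U i))"
        by (simp add: hausdorff_gauge_def)
      also have "\<dots> \<le> (\<Sum>i. ennreal (hausdorff_gauge 0 (U i)))"
        by (rule ennreal_le_suminf)
      finally have "1 \<le> (\<Sum>i. ennreal (hausdorff_gauge 0 (U i)))" .
      from leD[OF this] sum show False by (rule notE)
    qed
    with U have "S = {}" by simp
    moreover have "hausdorff_measure (b/2) ({} :: 'a set) = 0"
      using \<open>s < b\<close> \<open>s = 0\<close>
      by (intro hausdorff_measure_eq_0I exI[of _ "\<lambda>_. {}"]) simp_all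
    ultimately show False
      using pos[of "b/2"] \<open>s < b\<close> \<open>s = 0\<close> by simp
  qed
qed

section \<open>Descending through a cover\<close>

text \<open>
  The total cost of the members that meet \<open>X\<close>, in a cover \<open>U\<close> whose \<open>i\<close>-th member has size \<open>d i\<close>
  and cost \<open>d i powr s\<close>.
\<close>

definition cover_cost :: "real \<Rightarrow> (nat \<Rightarrow> real set) \<Rightarrow> (nat \<Rightarrow> real) \<Rightarrow> real set \<Rightarrow> real" where
  "cover_cost s U d X = (\<Sum>i. if U i \<inter> X \<noteq> {} then d i powr s else 0)"

lemma summable_cover_cost:
  fixes d :: "nat \<Rightarrow> real"
  assumes "summable (\<lambda>i. d i powr s)"
  shows "summable (\<lambda>i. if U i \<inter> X \<noteq> {} then d i powr s else 0)"
  by (rule summable_comparison_test'[OF assms, of 0]) auto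

lemma cover_cost_ge_term:
  fixes d :: "nat \<Rightarrow> real"
  assumes "summable (\<lambda>i. d i powr s)" and "U i \<inter> X \<noteq> {}"
  shows "d i powr s \<le> cover_cost s U d X"
  unfolding cover_cost_def
  using sum_le_suminf[OF summable_cover_cost[OF assms(1), of U X], of "{i}"] assms(2) by simp

lemma card_int_le_of_spread:
  fixes K :: "int set"
  assumes "finite K" and "0 \<le> D" and "\<And>k k'. k \<in> K \<Longrightarrow> k' \<in> K \<Longrightarrow> real_of_int (k - k') \<le> D"
  shows "real (card K) \<le> 1 + D"
proof (cases "K = {}")
  case False
  have "K \<subseteq> {Min K..Max K}" using assms(1) by auto
  then have "card K \<le> card {Min K..Max K}" by (intro card_mono) auto
  also have "\<dots> = nat (Max K - Min K + 1)" by simp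
  finally have "real (card K) \<le> real_of_int (Max K - Min K + 1)"
    using False assms(1) by (smt (verit) Min_in Max_ge nat_0_le of_int_of_nat_eq of_nat_mono)
  also have "\<dots> \<le> 1 + D" using assms(3)[of "Max K" "Min K"] assms(1) False by simp
  finally show ?thesis .
qed (use assms in auto)

text \<open>
  The selection step. If \<open>I\<close> has cost below \<open>(L / 32) powr s\<close>, where \<open>L\<close> is its length in the
  application, then among many pieces \<open>J k\<close> of \<open>I\<close>, separated in proportion to \<open>g\<close>, one has cost below
  \<open>(r / 32) powr s\<close>. The hypothesis makes the members that meet \<open>I\<close> shorter than \<open>L / 32\<close>, so the
  total length of those of size at least \<open>g\<close> is too small for them to meet more than half of the
  pieces. The other members meet at most two pieces each, so they cost little on average.
  Both effects are captured by one weighted average, in which a member of size at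
  least \<open>g\<close> counts as the whole allowance \<open>(r / 32) powr s\<close> of a piece.
\<close>

lemma exists_piece_of_small_cost:
  fixes J :: "int \<Rightarrow> real set"
  assumes s: "0 < s" "s < 1" and L: "L > 0" and r: "r > 0" and g: "g > 0"
    and dpos: "\<And>i. d i > 0" and summ: "summable (\<lambda>i. d i powr s)"
    and diam: "\<And>i x y. x \<in> U i \<Longrightarrow> y \<in> U i \<Longrightarrow> \<bar>x - y\<bar> \<le> d i"
    and K: "finite K" and JI: "\<And>k. k \<in> K \<Longrightarrow> J k \<subseteq> I"
    and sep: "\<And>k k' x y. k \<in> K \<Longrightarrow> k' \<in> K \<Longrightarrow> x \<in> J k \<Longrightarrow> y \<in> J k' \<Longrightarrow> g * real_of_int (k - k') \<le> \<bar>x - y\<bar>"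
    and cost: "cover_cost s U d I < (L / 32) powr s"
    and card1: "L / 8 \<le> g * real (card K)"
    and card2: "4 * L powr s \<le> real (card K) * r powr s"
  shows "\<exists>k\<in>K. cover_cost s U d (J k) < (r / 32) powr s"
proof (rule ccontr)
  assume "\<not> ?thesis"
  then have big: "(r / 32) powr s \<le> cover_cost s U d (J k)" if "k \<in> K" for k
    using that by (simp add: not_less)
  define T where "T = (r / 32) powr s"
  have T: "T > 0" using r by (simp add: T_def)
  define w where "w = (\<lambda>i. if d i < g then d i powr s else T)"
  have w0: "w i \<ge> 0" for i using T by (simp add: w_def)
  define C where "C = 2 + T * (2 / g) * (L / 32) powr (1 - s)"
  have C: "C > 0" using T g by (simp add: C_def add_pos_nonneg)
  have small: "d i < L / 32" if "U i \<inter> I \<noteq> {}" for i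
  proof -
    have "d i powr s < (L / 32) powr s"
      using cover_cost_ge_term[where U = U and X = I, OF summ that] cost by simp
    then show ?thesis
      using s L powr_mono2[of s "L / 32" "d i"] by linarith
  qed
  have wC: "w i * (1 + d i / g) \<le> C * d i powr s" if "U i \<inter> I \<noteq> {}" for i
  proof (cases "d i < g")
    case True
    have "d i powr s * (1 + d i / g) \<le> d i powr s * 2"
      using True g by (intro mult_left_mono) (auto simp: field_simps)
    also have "\<dots> \<le> d i powr s * C"
      using T g by (intro mult_left_mono) (auto simp: C_def)
    finally show ?thesis using True by (simp add: w_def mult.commute)
  next
    case False
    have "d i = d i powr s * d i powr (1 - s)"
      using dpos[of i] by (simp flip: powr_add)
    also have "\<dots> \<le> d i powr s * (L / 32) powr (1 - s)"
      using small[OF that] dpos[of i] s by (intro mult_left_mono powr_mono2) auto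
    finally have d: "d i \<le> d i powr s * (L / 32) powr (1 - s)" .
    have "T * (1 + d i / g) \<le> T * ((2 / g) * d i)"
      using False g T by (intro mult_left_mono) (auto simp: field_simps)
    also have "\<dots> \<le> T * ((2 / g) * (d i powr s * (L / 32) powr (1 - s)))"
      using d g T by (intro mult_left_mono) auto
    also have "\<dots> \<le> C * d i powr s"
      by (simp add: C_def algebra_simps)
    finally show ?thesis using False by (simp add: w_def)
  qed
  define h where "h = (\<lambda>k i. if U i \<inter> J k \<noteq> {} then w i else 0)"
  have h_summable: "summable (h k)" if "k \<in> K" for k
  proof (rule summable_comparison_test'[OF summable_mult[OF summ, of C], of 0])
    fix i
    show "norm (h k i) \<le> C * d i powr s"
    proof (cases "U i \<inter> J k = {}")
      case True
      then show ?thesis using C by (simp add: h_def)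
    next
      case False
      then have "U i \<inter> I \<noteq> {}" using JI[OF that] by blast
      moreover have "w i * 1 \<le> w i * (1 + d i / g)"
        using w0 dpos[of i] g by (intro mult_left_mono) auto
      ultimately show ?thesis using wC[of i] w0[of i] False by (simp add: h_def)
    qed
  qed
  have T_le: "T \<le> (\<Sum>i. h k i)" if k: "k \<in> K" for k
  proof (cases "\<exists>i. U i \<inter> J k \<noteq> {} \<and> \<not> d i < g")
    case True
    then obtain i where "U i \<inter> J k \<noteq> {}" "\<not> d i < g" by blast
    then have "T = h k i" by (simp add: h_def w_def)
    also have "\<dots> \<le> (\<Sum>i. h k i)"
      using sum_le_suminf[OF h_summable[OF k], of "{i}"] w0 by (simp add: h_def)
    finally show ?thesis .
  next
    case False
    then have "(\<Sum>i. h k i) = cover_cost s U d (J k)"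
      unfolding cover_cost_def by (intro suminf_cong) (auto simp: h_def w_def)
    then show ?thesis using big[OF k] by (simp add: T_def)
  qed
  have "real (card K) * T \<le> (\<Sum>k\<in>K. \<Sum>i. h k i)"
    using sum_bounded_below[of K T "\<lambda>k. \<Sum>i. h k i"] T_le by simp
  also have "\<dots> = (\<Sum>i. \<Sum>k\<in>K. h k i)"
    using h_summable by (intro suminf_sum[symmetric])
  also have "\<dots> \<le> (\<Sum>i. C * (if U i \<inter> I \<noteq> {} then d i powr s else 0))"
  proof (rule suminf_le)
    fix i
    let ?H = "{k \<in> K. U i \<inter> J k \<noteq> {}}"
    have sum: "(\<Sum>k\<in>K. h k i) = real (card ?H) * w i"
      using K by (simp add: h_def sum.If_cases Int_def)
    show "(\<Sum>k\<in>K. h k i) \<le> C * (if U i \<inter> I \<noteq> {} then d i powr s else 0)"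
    proof (cases "U i \<inter> I = {}")
      case True
      then have "U i \<inter> J k = {}" if "k \<in> K" for k using JI[OF that] by blast
      then have "?H = {}" by blast
      then have "card ?H = 0" by (simp only: card.empty)
      then show ?thesis using True sum by (simp only: of_nat_0) simp
    next
      case False
      have "real (card ?H) \<le> 1 + d i / g"
      proof (rule card_int_le_of_spread)
        fix k k' assume kk: "k \<in> ?H" "k' \<in> ?H"
        then obtain x y where xy: "x \<in> U i" "x \<in> J k" "y \<in> U i" "y \<in> J k'" by blast
        then have "g * real_of_int (k - k') \<le> d i"
          using sep[of k k' x y] diam[of x i y] kk by auto
        then show "real_of_int (k - k') \<le> d i / g" using g by (simp add: field_simps)
      qed (use K dpos[of i] g in auto)
      then have "real (card ?H) * w i \<le> w i * (1 + d i / g)"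
        using w0[of i] by (subst mult.commute) (rule mult_left_mono)
      then show ?thesis using wC[OF False] sum False by simp
    qed
  next
    show "summable (\<lambda>i. \<Sum>k\<in>K. h k i)" using h_summable by (rule summable_sum)
    show "summable (\<lambda>i. C * (if U i \<inter> I \<noteq> {} then d i powr s else 0))"
      by (intro summable_mult summable_cover_cost summ)
  qed
  also have "\<dots> = C * cover_cost s U d I"
    unfolding cover_cost_def by (intro suminf_mult summable_cover_cost summ)
  also have "\<dots> < C * (L / 32) powr s"
    using C cost by simp
  also have "\<dots> = 2 * (L / 32) powr s + T * (2 / g) * ((L / 32) powr s * (L / 32) powr (1 - s))"
    by (simp add: C_def algebra_simps)
  also have "(L / 32) powr s * (L / 32) powr (1 - s) = L / 32"
    using L by (simp flip: powr_add)
  also have "2 * (L / 32) powr s + T * (2 / g) * (L / 32) \<le> real (card K) * T / 2 + real (card K) * T / 2"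
  proof (rule add_mono)
    have "4 * (L / 32) powr s \<le> real (card K) * T"
      using card2 L r by (simp add: T_def powr_divide field_simps)
    then show "2 * (L / 32) powr s \<le> real (card K) * T / 2" by simp
    have "(2 / g) * (L / 32) \<le> real (card K) / 2"
      using card1 g by (simp add: field_simps)
    then have "T * ((2 / g) * (L / 32)) \<le> T * (real (card K) / 2)"
      using T by (intro mult_left_mono) auto
    then show "T * (2 / g) * (L / 32) \<le> real (card K) * T / 2" by (simp add: mult_ac)
  qed
  finally show False by simp
qed

section \<open>A lower bound for the dimension from good rational approximations\<close>

lemma dist_nearest_int_le: "dist_nearest_int x \<le> \<bar>x - of_int m\<bar>"
  unfolding dist_nearest_int_def using infdist_le[of "of_int m :: real" \<int> x] by (simp add: dist_real_def)

text \<open>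
  If \<open>p / q\<close> is a reduced fraction with \<open>\<bar>\<alpha> - p / q\<bar> < 1 / q\<^sup>2\<close>, then modulo \<open>1\<close> the
  multiples \<open>n\<alpha>\<close> with \<open>q \<le> n < 2q\<close> lie within \<open>2 / q\<close> of the residues \<open>j / q\<close>, and each residue is
  attained.
\<close>

lemma multiple_near_residue:
  fixes \<alpha> :: real and p j :: int and q :: nat
  assumes q: "q > 0" and cop: "coprime p (int q)" and approx: "\<bar>\<alpha> - p / q\<bar> < 1 / real q ^ 2"
  obtains n :: nat and i :: int where "q \<le> n" "n < 2 * q" "\<bar>n * \<alpha> + i - j / q\<bar> \<le> 2 / q"
proof -
  obtain x where x: "[p * x = j] (mod int q)"
    using cong_solve_coprime_int[OF cop] by (metis cong_scalar_right mult.assoc mult.right_neutral mult.commute)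
  define n where "n = q + nat (x mod int q)"
  have xq: "0 \<le> x mod int q" "x mod int q < int q" using q by auto
  have n: "int n = int q + x mod int q" using xq by (simp add: n_def)
  have "[int n = x] (mod int q)" unfolding n cong_def by simp
  then have "[p * int n = j] (mod int q)"
    using x cong_scalar_left cong_trans by blast
  then obtain i where i: "j = p * int n + int q * i"
    by (metis cong_iff_lin)
  have nq: "q \<le> n" "n < 2 * q" using n xq by linarith+
  have "real_of_int j = p * n + q * i" by (simp add: i)
  then have "n * \<alpha> + i - j / q = n * (\<alpha> - p / q)"
    using q by (simp add: field_simps)
  also have "\<bar>\<dots>\<bar> = n * \<bar>\<alpha> - p / q\<bar>" by (simp add: abs_mult)
  also have "\<dots> \<le> (2 * real q) * (1 / real q ^ 2)"
    using nq approx by (intro mult_mono) auto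
  also have "\<dots> = 2 / q" using q by (simp add: power2_eq_square)
  finally show thesis using that nq by blast
qed

text \<open>
  The selection step applied to intervals around multiples of \<open>\<alpha>\<close>: inside an interval of
  small cost there is a shorter one, again of small cost, all of whose points are approximated
  by the same \<open>n\<alpha>\<close> with \<open>n > n0\<close>.
\<close>

lemma descent_step:
  fixes \<phi> :: "nat \<Rightarrow> real"
  assumes s: "0 < s" "s < t" and t: "t \<le> 1"
    and mono: "\<And>m n. 1 \<le> m \<Longrightarrow> m \<le> n \<Longrightarrow> \<phi> n \<le> \<phi> m"
    and good: "\<And>R. \<exists>q p. R \<le> q \<and> coprime p (int q) \<and> \<bar>\<alpha> - real_of_int p / real q\<bar> < 1 / real q ^ 2
                 \<and> real q powr (- 1 / t) \<le> \<phi> (2 * q)"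
    and dpos: "\<And>i. d i > 0" and summ: "summable (\<lambda>i. d i powr s)"
    and diam: "\<And>i x y. x \<in> U i \<Longrightarrow> y \<in> U i \<Longrightarrow> \<bar>x - y\<bar> \<le> d i"
    and L: "L > 0" and cost: "cover_cost s U d {a..a + L} < (L / 32) powr s"
  shows "\<exists>a' L' n. n0 < n \<and> 0 < L' \<and> L' \<le> L / 2 \<and> {a'..a' + L'} \<subseteq> {a..a + L} \<and>
           (\<forall>y\<in>{a'..a' + L'}. dist_nearest_int (real n * \<alpha> - y) < \<phi> n) \<and>
           cover_cost s U d {a'..a' + L'} < (L' / 32) powr s"
proof -
  have "1 - s / t > 0" using s by simp
  then have "filterlim (\<lambda>q. real q powr (1 - s / t)) at_top sequentially"
    by real_asymp
  then have "\<forall>\<^sub>F q in sequentially. 64 * L powr s / L \<le> real q powr (1 - s / t)"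
    by (simp add: filterlim_at_top)
  then obtain R where R: "\<And>q. q \<ge> R \<Longrightarrow> 64 * L powr s / L \<le> real q powr (1 - s / t)"
    by (auto simp: eventually_sequentially)
  \<comment> \<open>The bound \<open>28 / L\<close> leaves at least \<open>q * L / 16\<close> of the fractions \<open>8 * k / q\<close> well inside the
    interval.\<close>
  define R' where "R' = max (max R (Suc n0)) (nat \<lceil>28 / L\<rceil>)"
  obtain q p where "R' \<le> q" and cop: "coprime p (int q)"
    and approx: "\<bar>\<alpha> - real_of_int p / real q\<bar> < 1 / real q ^ 2"
    and \<phi>q: "real q powr (- 1 / t) \<le> \<phi> (2 * q)"
    using good by blast
  then have qR: "q \<ge> R" "q > n0" and "nat \<lceil>28 / L\<rceil> \<le> q"
    by (auto simp: R'_def)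
  then have "28 / L \<le> real q" by linarith
  then have qL: "28 \<le> real q * L" using L by (simp add: field_simps)
  have q: "q > 0" using qR by simp
  define r where "r = real q powr (- 1 / t)"
  have r0: "r > 0" using q by (simp add: r_def)
  have "r \<le> real q powr (- 1)"
    unfolding r_def using q s t by (intro powr_mono) (auto simp: field_simps)
  then have r1: "r \<le> 1 / q" using q by (simp add: powr_minus_divide)
  \<comment> \<open>Only every eighth residue is used: the chosen multiple of \<open>\<alpha>\<close> may be \<open>2 / q\<close> away from its
    residue, and this keeps the intervals separated by multiples of \<open>2 / q\<close>.\<close>
  have "\<forall>k::int. \<exists>n i. q \<le> n \<and> n < 2 * q \<and> \<bar>real n * \<alpha> + real_of_int i - real_of_int (8 * k) / q\<bar> \<le> 2 / q"
    using multiple_near_residue[OF q cop approx] by metis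
  then obtain n i where n: "\<And>k. q \<le> n k" "\<And>k. n k < 2 * q"
    and near: "\<And>k. \<bar>real (n k) * \<alpha> + real_of_int (i k) - real_of_int (8 * k) / q\<bar> \<le> 2 / q"
    by metis
  define c where "c = (\<lambda>k. real (n k) * \<alpha> + real_of_int (i k))"
  define J where "J = (\<lambda>k. {c k - r / 2..c k - r / 2 + r})"
  define K where "K = {\<lceil>(q * a + 3) / 8\<rceil>..\<lfloor>(q * (a + L) - 3) / 8\<rfloor>}"
  have Jbound: "(8 * real_of_int k - 3) / q \<le> x \<and> x \<le> (8 * real_of_int k + 3) / q" if "x \<in> J k" for x k
  proof -
    have "c k - r / 2 \<le> x" "x \<le> c k + r / 2" using that by (auto simp: J_def)
    moreover have "r / 2 \<le> 1 / q" using r0 r1 by linarith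
    ultimately have "\<bar>x - 8 * real_of_int k / q\<bar> \<le> 3 / q"
      using near[of k] unfolding c_def by (simp add: abs_le_iff)
    then show ?thesis by (auto simp: abs_le_iff diff_divide_distrib add_divide_distrib)
  qed
  have JI: "J k \<subseteq> {a..a + L}" if "k \<in> K" for k
  proof
    fix x assume "x \<in> J k"
    then have x: "(8 * real_of_int k - 3) / q \<le> x" "x \<le> (8 * real_of_int k + 3) / q" using Jbound by blast+
    have "(q * a + 3) / 8 \<le> k" "k \<le> (q * (a + L) - 3) / 8"
      using that by (simp_all add: K_def ceiling_le_iff le_floor_iff)
    then have "a \<le> (8 * real_of_int k - 3) / q" "(8 * real_of_int k + 3) / q \<le> a + L"
      using q by (simp_all add: field_simps)
    then show "x \<in> {a..a + L}" using x by auto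
  qed
  have cardK: "q * L / 16 \<le> real (card K)"
  proof -
    have "(q * (a + L) - 3) / 8 - (q * a + 3) / 8 = (q * L - 6) / 8"
      by (simp add: field_simps)
    then have "(q * L - 6) / 8 - 1
        \<le> real_of_int (\<lfloor>(q * (a + L) - 3) / 8\<rfloor> - \<lceil>(q * a + 3) / 8\<rceil> + 1)"
      using real_of_int_floor_gt_diff_one[of "(q * (a + L) - 3) / 8"]
        of_int_ceiling_diff_one_le[of "(q * a + 3) / 8"] by linarith
    also have "\<dots> \<le> real (card K)" by (simp add: K_def)
    finally show ?thesis using qL by (simp add: field_simps)
  qed
  have "\<exists>k\<in>K. cover_cost s U d (J k) < (r / 32) powr s"
  proof (rule exists_piece_of_small_cost[where g = "2 / q", OF _ _ L r0 _ dpos summ diam])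
    show "2 / real q * real_of_int (k - k') \<le> \<bar>x - y\<bar>" if "x \<in> J k" "y \<in> J k'" for k k' x y
    proof (cases "k \<le> k'")
      case True
      then have "2 / real q * real_of_int (k - k') \<le> 0"
        using q by (intro mult_nonneg_nonpos) auto
      then show ?thesis by linarith
    next
      case False
      then have "1 \<le> real_of_int (k - k')" by simp
      then have "2 * real_of_int (k - k') \<le> (8 * real_of_int k - 3) - (8 * real_of_int k' + 3)"
        by simp
      then have "2 * real_of_int (k - k') / q \<le> ((8 * real_of_int k - 3) - (8 * real_of_int k' + 3)) / q"
        by (rule divide_right_mono) simp
      also have "\<dots> = (8 * real_of_int k - 3) / q - (8 * real_of_int k' + 3) / q"
        by (rule diff_divide_distrib)
      also have "\<dots> \<le> x - y" using Jbound[OF that(1)] Jbound[OF that(2)] by linarith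
      finally show ?thesis by simp
    qed
    show "L / 8 \<le> 2 / real q * real (card K)"
      using cardK q by (simp add: field_simps)
    have "4 * L powr s = q * L / 16 * (64 * L powr s / L) / q"
      using q L by simp
    also have "\<dots> \<le> q * L / 16 * real q powr (1 - s / t) / q"
      using R[OF qR(1)] q L by (intro divide_right_mono mult_left_mono) auto
    also have "\<dots> = q * L / 16 * r powr s"
    proof -
      have "real q powr (1 - s / t) = real q powr 1 * real q powr (- 1 / t * s)"
        by (subst powr_add[symmetric]) simp
      then show ?thesis using q by (simp add: r_def powr_powr)
    qed
    also have "\<dots> \<le> real (card K) * r powr s"
      using cardK by (intro mult_right_mono) auto
    finally show "4 * L powr s \<le> real (card K) * r powr s" .
  qed (use s t q JI cost in \<open>auto simp: K_def\<close>)
  then obtain k where k: "k \<in> K" "cover_cost s U d (J k) < (r / 32) powr s" by blast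
  have "dist_nearest_int (n k * \<alpha> - y) < \<phi> (n k)" if "y \<in> J k" for y
  proof -
    have "dist_nearest_int (n k * \<alpha> - y) \<le> \<bar>c k - y\<bar>"
      using dist_nearest_int_le[of "n k * \<alpha> - y" "- i k"] by (simp add: c_def algebra_simps)
    also have "\<dots> \<le> r / 2" using that by (auto simp: J_def abs_if)
    also have "\<dots> < r" using r0 by simp
    also have "\<dots> \<le> \<phi> (n k)" using \<phi>q mono[of "n k" "2 * q"] n[of k] q by (simp add: r_def)
    finally show ?thesis .
  qed
  moreover have "r \<le> L / 2"
  proof -
    have "1 / q \<le> L / 2" using qL q by (simp add: field_simps)
    then show ?thesis using r1 by simp
  qed
  ultimately show ?thesis
    using k JI[OF k(1)] r0 qR(2) n(1)[of k]
    by (intro exI[of _ "c k - r / 2"] exI[of _ r] exI[of _ "n k"]) (auto simp: J_def)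
qed

text \<open>
  Were the set null, it would have a cover cheap enough for the selection step to be iterated
  for ever inside \<open>{0..1}\<close>. The intersection of the chosen intervals is a point of the set that
  lies in no member of the cover.
\<close>

lemma hausdorff_measure_inhom_approx_set_nonzero:
  fixes \<phi> :: "nat \<Rightarrow> real"
  assumes s: "0 < s" "s < t" and t: "t \<le> 1"
    and mono: "\<And>m n. 1 \<le> m \<Longrightarrow> m \<le> n \<Longrightarrow> \<phi> n \<le> \<phi> m"
    and good: "\<And>R. \<exists>q p. R \<le> q \<and> coprime p (int q) \<and> \<bar>\<alpha> - real_of_int p / real q\<bar> < 1 / real q ^ 2
                 \<and> real q powr (- 1 / t) \<le> \<phi> (2 * q)"
  shows "hausdorff_measure s (inhom_approx_set \<phi> \<alpha>) \<noteq> 0"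
proof
  assume null: "hausdorff_measure s (inhom_approx_set \<phi> \<alpha>) = 0"
  define e :: real where "e = (1 / 32) powr s / 2"
  have e: "e > 0" by (simp add: e_def)
  from hausdorff_measure_eq_0D[OF s(1) null e] obtain U :: "nat \<Rightarrow> real set" where
    U': "inhom_approx_set \<phi> \<alpha> \<subseteq> (\<Union>i. U i) \<and> (\<forall>i. bounded (U i))
      \<and> (\<Sum>i. ennreal (diameter (U i) powr s)) < ennreal e"
    by (rule exE)
  then have U: "inhom_approx_set \<phi> \<alpha> \<subseteq> (\<Union>i. U i)" and bdd: "\<And>i. bounded (U i)"
    and sum: "(\<Sum>i. ennreal (diameter (U i) powr s)) < ennreal e"
    by simp_all
  have "(\<Sum>i. ennreal (diameter (U i) powr s)) \<noteq> top"
    using sum by (rule less_imp_neq[OF less_le_trans]) simp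
  then have summ0: "summable (\<lambda>i. diameter (U i) powr s)"
    by (intro summable_suminf_not_top) simp_all
  have sum0: "(\<Sum>i. diameter (U i) powr s) < e"
  proof (rule ennreal_less_iff[THEN iffD1])
    show "0 \<le> (\<Sum>i. diameter (U i) powr s)" by (rule suminf_nonneg[OF summ0 powr_ge_zero])
    show "ennreal (\<Sum>i. diameter (U i) powr s) < ennreal e"
      using sum by (simp only: suminf_ennreal2[OF powr_ge_zero summ0])
  qed
  \<comment> \<open>Enlarging the sizes makes them positive, and adds exactly \<open>e\<close> to the total cost.\<close>
  define d where "d = (\<lambda>i. (diameter (U i) powr s + e * (1/2) ^ Suc i) powr (1 / s))"
  have ds: "d i powr s = diameter (U i) powr s + e * (1/2) ^ Suc i" for i
    using s e by (simp add: d_def powr_powr add_nonneg_pos)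
  have dpos: "d i > 0" for i
    using e by (simp add: d_def add_nonneg_pos less_imp_neq[symmetric])
  have diam: "\<bar>x - y\<bar> \<le> d i" if "x \<in> U i" "y \<in> U i" for i x y
  proof -
    have "diameter (U i) = (diameter (U i) powr s) powr (1 / s)"
      using s diameter_ge_0[OF bdd[of i]] by (simp add: powr_powr)
    also have "\<dots> \<le> d i" unfolding d_def using s e by (intro powr_mono2) auto
    finally show ?thesis
      using diameter_bounded_bound[OF bdd[of i] that] by (simp add: dist_real_def)
  qed
  have half: "(\<lambda>i. e * (1/2) ^ Suc i) sums e"
    using sums_mult[OF power_half_series, of e] by simp
  have summ: "summable (\<lambda>i. d i powr s)"
    unfolding ds using summ0 sums_summable[OF half] by (rule summable_add)
  have sumd: "(\<Sum>i. d i powr s) < (1 / 32) powr s"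
    unfolding ds using suminf_add[OF summ0 sums_summable[OF half]] sums_unique[OF half] sum0
    by (simp add: e_def)
  have "cover_cost s U d {0..0 + 1} \<le> (\<Sum>i. d i powr s)"
    unfolding cover_cost_def using summable_cover_cost[OF summ] summ by (intro suminf_le) auto
  then have init: "cover_cost s U d {0..0 + 1} < (1 / 32) powr s" using sumd by simp
  define P where "P = (\<lambda>(a::real, L::real, n::nat). 0 < L \<and> cover_cost s U d {a..a + L} < (L / 32) powr s)"
  define Q where "Q = (\<lambda>(a::real, L::real, n::nat) (a', L', n'). n < n' \<and> L' \<le> L / 2 \<and>
     {a'..a' + L'} \<subseteq> {a..a + L} \<and> (\<forall>y\<in>{a'..a' + L'}. dist_nearest_int (real n' * \<alpha> - y) < \<phi> n'))"
  have "\<exists>f. \<forall>k. P (f k) \<and> Q (f k) (f (Suc k))"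
  proof (rule dependent_nat_choice)
    show "\<exists>x. P x" using init by (intro exI[of _ "(0, 1, 0)"]) (simp add: P_def)
  next
    fix x assume "P x"
    obtain a L n0 where x: "x = (a, L, n0)" by (metis prod.exhaust)
    have "L > 0" "cover_cost s U d {a..a + L} < (L / 32) powr s" using \<open>P x\<close> by (auto simp: P_def x)
    from descent_step[OF s t mono good dpos summ diam this, of n0]
    show "\<exists>y. P y \<and> Q x y" by (auto simp: P_def Q_def x)
  qed
  then obtain f where f: "\<And>k. P (f k)" "\<And>k. Q (f k) (f (Suc k))" by blast
  define a where "a = (\<lambda>k. fst (f k))"
  define L where "L = (\<lambda>k. fst (snd (f k)))"
  define n where "n = (\<lambda>k. snd (snd (f k)))"
  have feq: "f k = (a k, L k, n k)" for k by (simp add: a_def L_def n_def)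
  have L0: "L k > 0" and cost: "cover_cost s U d {a k..a k + L k} < (L k / 32) powr s" for k
    using f(1)[of k] by (auto simp: P_def feq)
  have n_less: "n k < n (Suc k)" and L_half: "L (Suc k) \<le> L k / 2"
    and nest: "{a (Suc k)..a (Suc k) + L (Suc k)} \<subseteq> {a k..a k + L k}"
    and close: "y \<in> {a (Suc k)..a (Suc k) + L (Suc k)} \<Longrightarrow> dist_nearest_int (n (Suc k) * \<alpha> - y) < \<phi> (n (Suc k))"
    for k y using f(2)[of k] by (auto simp: Q_def feq)
  have decr: "{a k'..a k' + L k'} \<subseteq> {a k..a k + L k}" if "k \<le> k'" for k k'
    using lift_Suc_antimono_le[of "\<lambda>k. {a k..a k + L k}", OF nest that] .
  have "(\<Inter>k. {a k..a k + L k}) \<noteq> {}"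
  proof (rule compact_nest)
    show "{a k..a k + L k} \<noteq> {}" for k using L0[of k] by simp
  qed (use decr in auto)
  then obtain y where y: "\<And>k. y \<in> {a k..a k + L k}" by blast
  have nmono: "strict_mono n" using n_less by (simp add: strict_mono_Suc_iff)
  have "range (\<lambda>k. n (Suc k)) \<subseteq> {m. 1 \<le> m \<and> dist_nearest_int (real m * \<alpha> - y) < \<phi> m}"
    using close[OF y] n_less by (auto simp: Suc_le_eq intro: le_less_trans[OF le0])
  moreover have "infinite (range (\<lambda>k. n (Suc k)))"
    using nmono by (intro range_inj_infinite) (auto simp: inj_def strict_mono_eq)
  ultimately have "y \<in> inhom_approx_set \<phi> \<alpha>"
    unfolding inhom_approx_set_def using infinite_super by blast
  then obtain i where i: "y \<in> U i" using U by blast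
  have d_less: "d i < L k" for k
  proof -
    have "d i powr s \<le> cover_cost s U d {a k..a k + L k}"
      using y[of k] i by (intro cover_cost_ge_term summ) blast
    also have "\<dots> < (L k / 32) powr s" by (rule cost)
    also have "\<dots> \<le> L k powr s" using L0[of k] s by (intro powr_mono2) auto
    finally show ?thesis
      using s L0[of k] powr_mono2[of s "L k" "d i"] by linarith
  qed
  have L_le: "L k \<le> L 0 * (1/2) ^ k" for k
  proof (induction k)
    case (Suc k)
    have "L (Suc k) \<le> L k / 2" by (rule L_half)
    also have "\<dots> \<le> L 0 * (1/2) ^ Suc k" using Suc by simp
    finally show ?case .
  qed simp
  have "(\<lambda>k. L 0 * (1/2) ^ k) \<longlonglongrightarrow> L 0 * 0"
    by (intro tendsto_mult_left LIMSEQ_power_zero) auto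
  moreover have "d i \<le> L 0 * (1/2) ^ k" for k
    using d_less[of k] L_le[of k] by linarith
  ultimately have "d i \<le> L 0 * 0" using LIMSEQ_le_const by blast
  then show False using dpos[of i] by simp
qed

section \<open>Rational approximations and the Diophantine type\<close>

lemma dist_nearest_int_attained: "\<exists>m::int. dist_nearest_int x = \<bar>x - of_int m\<bar>"
proof -
  have "(\<int> :: real set) \<noteq> {}" using Ints_0 by blast
  from infdist_attains_inf[OF closed_Ints this, of x] obtain y :: real
    where "y \<in> \<int>" "dist_nearest_int x = dist x y"
    unfolding dist_nearest_int_def by blast
  then show ?thesis by (auto simp: Ints_def dist_real_def)
qed

lemma dist_nearest_int_nonneg: "0 \<le> dist_nearest_int x"
  by (simp add: dist_nearest_int_def infdist_nonneg)

lemma irrational_multiples_away_from_int: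
  fixes \<alpha> :: real and R :: nat
  assumes "\<alpha> \<notin> \<rat>"
  shows "\<exists>\<delta>>0. \<forall>(q::nat) (p::int). 1 \<le> q \<longrightarrow> q \<le> R \<longrightarrow> \<delta> \<le> \<bar>q * \<alpha> - p\<bar>"
proof -
  define D where "D = insert 1 ((\<lambda>q. dist_nearest_int (real q * \<alpha>)) ` {1..R})"
  have pos: "x > 0" if "x \<in> D" for x
  proof (cases "x = 1")
    case False
    then obtain q :: nat where q: "1 \<le> q" "x = dist_nearest_int (q * \<alpha>)" using \<open>x \<in> D\<close> by (auto simp: D_def)
    obtain m :: int where m: "x = \<bar>q * \<alpha> - m\<bar>" using dist_nearest_int_attained q(2) by metis
    have "q * \<alpha> \<noteq> m"
    proof
      assume "q * \<alpha> = m"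
      then have "\<alpha> = of_int m / of_nat q" using q by (simp add: field_simps)
      then show False using assms by simp
    qed
    then show ?thesis using m by simp
  qed simp
  have fin: "finite D" "D \<noteq> {}" by (simp_all add: D_def)
  show ?thesis
  proof (intro exI[of _ "Min D"] conjI allI impI)
    show "Min D > 0" using pos Min_in[OF fin] by blast
    fix q :: nat and p :: int assume "1 \<le> q" "q \<le> R"
    then have "Min D \<le> dist_nearest_int (q * \<alpha>)"
      by (intro Min_le fin) (simp add: D_def)
    also have "\<dots> \<le> \<bar>q * \<alpha> - p\<bar>" by (rule dist_nearest_int_le)
    finally show "Min D \<le> \<bar>q * \<alpha> - p\<bar>" .
  qed
qed

text \<open>
  Cancelling a common factor only improves an approximation; since \<open>\<alpha>\<close> is irrational, the
  reduced denominators are unbounded too.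
\<close>

lemma reduced_approximations:
  fixes \<alpha> \<theta> :: real
  assumes \<alpha>: "\<alpha> \<notin> \<rat>" and \<theta>: "1 \<le> \<theta>"
    and approx: "\<And>R. \<exists>n p. R \<le> n \<and> 1 \<le> n \<and> \<bar>real n * \<alpha> - real_of_int p\<bar> < real n powr - \<theta>"
  shows "\<exists>q p. R \<le> q \<and> 1 \<le> q \<and> coprime p (int q) \<and> \<bar>real q * \<alpha> - real_of_int p\<bar> < real q powr - \<theta>"
proof -
  obtain \<delta> where \<delta>: "\<delta> > 0" and away: "\<And>(q::nat) (p::int). 1 \<le> q \<Longrightarrow> q \<le> R \<Longrightarrow> \<delta> \<le> \<bar>q * \<alpha> - p\<bar>"
    using irrational_multiples_away_from_int[OF \<alpha>, of R] by auto
  obtain n m where n: "nat \<lceil>1 / \<delta>\<rceil> \<le> n" "1 \<le> n" and nm: "\<bar>real n * \<alpha> - real_of_int m\<bar> < real n powr - \<theta>"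
    using approx by blast
  have "1 / \<delta> \<le> real n" using n by linarith
  then have "1 / real n \<le> \<delta>" using \<delta> n by (simp add: field_simps)
  have "real n powr - \<theta> \<le> real n powr - 1" using n \<theta> by (intro powr_mono) auto
  also have "\<dots> = 1 / n" using n by (simp add: powr_minus_divide)
  finally have n\<theta>: "real n powr - \<theta> \<le> \<delta>" using \<open>1 / real n \<le> \<delta>\<close> by simp
  define d where "d = gcd m (int n)"
  have d: "d \<ge> 1" using n by (simp add: d_def) (metis gcd_pos_int int_one_le_iff_zero_less of_nat_0_less_iff less_eq_Suc_le One_nat_def less_numeral_extra(3))
  define p where "p = m div d"
  define q where "q = nat (int n div d)"
  have dm: "m = d * p" unfolding p_def d_def by simp
  have dn: "int n = d * (int n div d)" unfolding d_def by simp
  have "int n div d > 0" using n dn d by (smt (verit) of_nat_0_less_iff zero_less_mult_iff less_eq_Suc_le One_nat_def)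
  then have q: "int q = int n div d" "q \<ge> 1" by (simp_all add: q_def)
  have dq: "real n = real_of_int d * real q"
    using dn q(1) by (metis of_int_mult of_int_of_nat_eq)
  have cop: "coprime p (int q)"
    unfolding q p_def d_def using n by (intro div_gcd_coprime) auto
  have "real n * \<alpha> - real_of_int m = real_of_int d * (q * \<alpha> - p)"
    by (simp add: dm dq algebra_simps)
  then have "\<bar>real n * \<alpha> - real_of_int m\<bar> = real_of_int d * \<bar>q * \<alpha> - p\<bar>"
    using d by (simp add: abs_mult)
  moreover have "1 * \<bar>q * \<alpha> - p\<bar> \<le> real_of_int d * \<bar>q * \<alpha> - p\<bar>"
    using d by (intro mult_right_mono) auto
  ultimately have small: "\<bar>q * \<alpha> - p\<bar> < real n powr - \<theta>" using nm by simp
  then have "\<not> q \<le> R" using away[of q p] q(2) n\<theta> by linarith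
  have "1 * real q \<le> real_of_int d * real q" using d by (intro mult_right_mono) auto
  then have "real q \<le> real n" by (simp add: dq)
  then have "real n powr - \<theta> \<le> real q powr - \<theta>"
    using q(2) \<theta> by (intro powr_mono2') auto
  with small have "\<bar>q * \<alpha> - p\<bar> < real q powr - \<theta>" by simp
  then show ?thesis using cop q(2) \<open>\<not> q \<le> R\<close> by (intro exI[of _ q] exI[of _ p]) auto
qed

lemma one_le_diophantine_type: "1 \<le> diophantine_type \<alpha>"
  unfolding diophantine_type_def by (intro Sup_upper) simp

text \<open>
  The exponent \<open>1\<close> is covered by Dirichlet's theorem. It needs separate treatment because the
  type may be equal to \<open>1\<close>.
\<close>

lemma approximations_below_diophantine_type:
  fixes \<alpha> \<theta> :: real
  assumes \<alpha>: "\<alpha> \<notin> \<rat>" and \<theta>: "\<theta> = 1 \<or> (1 \<le> \<theta> \<and> ereal \<theta> < diophantine_type \<alpha>)"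
  shows "\<exists>q p. R \<le> q \<and> 1 \<le> q \<and> coprime p (int q) \<and> \<bar>real q * \<alpha> - real_of_int p\<bar> < real q powr - \<theta>"
proof (rule reduced_approximations[OF \<alpha>])
  show "1 \<le> \<theta>" using \<theta> by auto
  show "\<exists>n p. R \<le> n \<and> 1 \<le> n \<and> \<bar>real n * \<alpha> - real_of_int p\<bar> < real n powr - \<theta>" for R
  proof (cases "\<theta> = 1")
    case True
    obtain \<delta> where \<delta>: "\<delta> > 0" and away: "\<And>(q::nat) (p::int). 1 \<le> q \<Longrightarrow> q \<le> R \<Longrightarrow> \<delta> \<le> \<bar>q * \<alpha> - p\<bar>"
      using irrational_multiples_away_from_int[OF \<alpha>, of R] by auto
    define M where "M = nat \<lceil>1 / \<delta>\<rceil> + 1"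
    have "1 / \<delta> \<le> real M" unfolding M_def by linarith
    moreover have "real M > 0" by (simp add: M_def)
    ultimately have M: "1 / real M \<le> \<delta>" using \<delta> by (simp add: field_simps)
    obtain h k where k: "0 < k" "k \<le> int M" and hk: "\<bar>of_int k * \<alpha> - of_int h\<bar> < 1 / real M"
      by (rule Dirichlet_approx[of M \<alpha>]) (simp add: M_def, rule that)
    define n where "n = nat k"
    have nk: "int n = k" "1 \<le> n" "n \<le> M" using k by (auto simp: n_def)
    then have kn: "real_of_int k = real n" by (metis of_int_of_nat_eq)
    have "1 / real M \<le> 1 / real n" using nk by (simp add: field_simps)
    then have "\<bar>real n * \<alpha> - h\<bar> < real n powr - \<theta>"
      using hk nk by (simp add: True powr_minus_divide kn)
    moreover have "\<not> n \<le> R"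
    proof
      assume "n \<le> R"
      then have "\<delta> \<le> \<bar>real n * \<alpha> - h\<bar>" using away nk(2) by blast
      then show False using hk M by (simp add: kn)
    qed
    ultimately show ?thesis using nk by (intro exI[of _ n] exI[of _ h]) auto
  next
    case False
    then have "1 \<le> \<theta>" "ereal \<theta> < diophantine_type \<alpha>" using \<theta> by auto
    then obtain x where x: "ereal \<theta> < x" "x \<in> insert 1 {ereal \<theta> | \<theta>. 1 \<le> \<theta> \<and>
        liminf (\<lambda>n. ereal (real n powr \<theta> * dist_nearest_int (real n * \<alpha>))) = 0}"
      unfolding diophantine_type_def less_Sup_iff by blast
    have "x \<noteq> 1" using x(1) \<open>1 \<le> \<theta>\<close> by (auto simp: one_ereal_def)
    then obtain \<theta>' where \<theta>': "\<theta> < \<theta>'"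
      "liminf (\<lambda>n. ereal (real n powr \<theta>' * dist_nearest_int (real n * \<alpha>))) = 0"
      using x by auto
    have "\<not> (\<forall>\<^sub>F n in sequentially. 1 \<le> ereal (real n powr \<theta>' * dist_nearest_int (real n * \<alpha>)))"
    proof
      assume "\<forall>\<^sub>F n in sequentially. 1 \<le> ereal (real n powr \<theta>' * dist_nearest_int (real n * \<alpha>))"
      from Liminf_bounded[OF this] \<theta>'(2) show False by simp
    qed
    then obtain n where n: "n \<ge> max R 1" "\<not> 1 \<le> ereal (real n powr \<theta>' * dist_nearest_int (real n * \<alpha>))"
      unfolding eventually_sequentially by blast
    obtain p :: int where p: "dist_nearest_int (real n * \<alpha>) = \<bar>n * \<alpha> - p\<bar>"
      using dist_nearest_int_attained by blast
    have "real n powr \<theta>' * \<bar>n * \<alpha> - p\<bar> < 1" using n(2) p by (simp add: one_ereal_def)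
    moreover have "real n powr \<theta> * \<bar>n * \<alpha> - p\<bar> \<le> real n powr \<theta>' * \<bar>n * \<alpha> - p\<bar>"
      using n(1) \<theta>'(1) by (intro mult_right_mono powr_mono) auto
    ultimately have "\<bar>n * \<alpha> - p\<bar> < real n powr - \<theta>"
      using n(1) by (simp add: powr_minus_divide field_simps)
    then show ?thesis using n(1) by (intro exI[of _ n] exI[of _ p]) auto
  qed
qed

lemma lower_bound_above_diophantine_type:
  fixes \<theta> :: real
  assumes "diophantine_type \<alpha> < ereal \<theta>"
  obtains c R where "c > 0" "\<And>n. R \<le> n \<Longrightarrow> c \<le> real n powr \<theta> * dist_nearest_int (real n * \<alpha>)"
proof -
  let ?f = "\<lambda>n. ereal (real n powr \<theta> * dist_nearest_int (real n * \<alpha>))"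
  have "ereal 1 < ereal \<theta>"
    using order.strict_trans1[OF one_le_diophantine_type[of \<alpha>] assms] by (simp add: one_ereal_def)
  have "liminf ?f \<noteq> 0"
  proof
    assume "liminf ?f = 0"
    then have "ereal \<theta> \<le> diophantine_type \<alpha>"
      unfolding diophantine_type_def using \<open>ereal 1 < ereal \<theta>\<close> by (intro Sup_upper) auto
    then show False using assms by simp
  qed
  moreover have "0 \<le> liminf ?f"
    by (intro Liminf_bounded always_eventually allI) (simp add: dist_nearest_int_nonneg)
  ultimately have "0 < liminf ?f" by simp
  then obtain c :: real where c: "ereal 0 < ereal c" "ereal c < liminf ?f"
    using ereal_dense2[of 0 "liminf ?f"] by (auto simp: zero_ereal_def)
  then have "\<forall>\<^sub>F n in sequentially. ereal c < ?f n" by (intro less_LiminfD)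
  then obtain R where "\<And>n. R \<le> n \<Longrightarrow> c < real n powr \<theta> * dist_nearest_int (real n * \<alpha>)"
    by (auto simp: eventually_sequentially)
  then show thesis using that[of c R] c by (simp add: less_imp_le)
qed

section \<open>Approximation functions with prescribed orders\<close>

text \<open>
  The function \<open>\<psi>\<close>, of order \<open>l\<close>, is raised to the constant \<open>r j\<close> on an initial part of the natural
  numbers ending at \<open>N j \<approx> r j powr (- u)\<close>, where the order \<open>u\<close> is attained. The
  sequence is so sparse that \<open>\<psi>\<close> is at least \<open>r (j + 1)\<close> immediately after \<open>N j\<close>.
\<close>

locale raised_approximation =
  fixes \<psi> r :: "nat \<Rightarrow> real" and N :: "nat \<Rightarrow> nat" and l u :: real
  assumes \<psi>_pos: "\<And>n. 1 \<le> n \<Longrightarrow> 0 < \<psi> n"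
    and \<psi>_mono: "\<And>m n. 1 \<le> m \<Longrightarrow> m \<le> n \<Longrightarrow> \<psi> n \<le> \<psi> m"
    and \<psi>_lim: "\<psi> \<longlonglongrightarrow> 0"
    and \<psi>_order: "(\<lambda>n. ln (real n) / - ln (\<psi> n)) \<longlonglongrightarrow> l"
    and r_pos: "\<And>j. 0 < r j"
    and r_mono: "\<And>i j. i \<le> j \<Longrightarrow> r j \<le> r i"
    and r_lim: "r \<longlonglongrightarrow> 0"
    and N_strict: "strict_mono N"
    and N_le: "\<And>j. real (N j) \<le> r j powr - u"
    and N_ge: "\<And>j. r j powr - u < real (N j) + 1"
    and sparse: "\<And>j. r (Suc j) \<le> \<psi> (N j + 1)"
    and l_less_u: "l < u"
begin

text \<open>The index \<open>j\<close> of the step \<open>{N (j - 1) + 1..N j}\<close> to which \<open>n\<close> belongs.\<close>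

definition step :: "nat \<Rightarrow> nat" where
  "step n = (LEAST j. n \<le> N j)"

text \<open>The raised approximation function.\<close>

definition \<phi> :: "nat \<Rightarrow> real" where
  "\<phi> n = max (\<psi> n) (r (step n))"

lemma le_N_step: "n \<le> N (step n)"
proof -
  have "n \<le> N n" by (rule strict_mono_imp_increasing[OF N_strict])
  then show ?thesis unfolding step_def by (rule LeastI)
qed

lemma step_le: "n \<le> N j \<Longrightarrow> step n \<le> j"
  unfolding step_def by (rule Least_le)

lemma step_mono: "m \<le> n \<Longrightarrow> step m \<le> step n"
  using le_N_step[of n] by (intro step_le) simp

lemma step_Suc_N: "step (N j + 1) = Suc j"
proof (rule antisym)
  show "step (N j + 1) \<le> Suc j"
    using strict_monoD[OF N_strict, of j "Suc j"] by (intro step_le) simp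
  have "\<not> N (step (N j + 1)) \<le> N j" using le_N_step[of "N j + 1"] by simp
  then show "Suc j \<le> step (N j + 1)"
    using strict_mono_less_eq[OF N_strict, of "step (N j + 1)" j] by simp
qed

lemma \<psi>_le_\<phi>: "\<psi> n \<le> \<phi> n"
  by (simp add: \<phi>_def)

lemma r_le_\<phi>: "n \<le> N j \<Longrightarrow> r j \<le> \<phi> n"
  using r_mono[OF step_le[of n j]] by (simp add: \<phi>_def le_max_iff_disj)

lemma \<phi>_pos: "0 < \<phi> n"
  using r_pos by (simp add: \<phi>_def less_max_iff_disj)

lemma \<phi>_mono: "1 \<le> m \<Longrightarrow> m \<le> n \<Longrightarrow> \<phi> n \<le> \<phi> m"
  unfolding \<phi>_def by (intro max.mono \<psi>_mono r_mono step_mono)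

lemma \<phi>_Suc_N: "\<phi> (N j + 1) = \<psi> (N j + 1)"
  unfolding \<phi>_def step_Suc_N using sparse by (rule max_absorb1)

lemma strict_mono_Suc_N: "strict_mono (\<lambda>j. N j + 1)"
  using N_strict by (simp add: strict_mono_def)

lemma \<phi>_lim: "\<phi> \<longlonglongrightarrow> 0"
proof (rule LIMSEQ_I)
  fix e :: real assume e: "0 < e"
  have "(\<lambda>j. \<psi> (N j + 1)) \<longlonglongrightarrow> 0"
    using LIMSEQ_subseq_LIMSEQ[OF \<psi>_lim strict_mono_Suc_N] by (simp add: o_def)
  then have "\<forall>\<^sub>F j in sequentially. \<psi> (N j + 1) < e" using e by (intro order_tendstoD)
  then obtain j where j: "\<psi> (N j + 1) < e" by (auto simp: eventually_sequentially)
  have "norm (\<phi> n - 0) < e" if "n \<ge> N j + 1" for n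
    using \<phi>_mono[of "N j + 1" n] that j \<phi>_Suc_N[of j] \<phi>_pos[of n] by simp
  then show "\<exists>no. \<forall>n\<ge>no. norm (\<phi> n - 0) < e" by blast
qed

lemma decreasing_to_zero_\<phi>: "decreasing_to_zero \<phi>"
  unfolding decreasing_to_zero_def using \<phi>_pos \<phi>_mono \<phi>_lim by simp

lemma eventually_\<phi>_less_1: "\<forall>\<^sub>F n in sequentially. 1 \<le> n \<and> \<phi> n < 1"
  using order_tendstoD(2)[OF \<phi>_lim zero_less_one] eventually_ge_at_top[of 1] by eventually_elim simp

text \<open>The lower order is attained along \<open>N j + 1\<close>, where \<open>\<phi>\<close> agrees with \<open>\<psi>\<close>.\<close>

lemma lower_order_\<phi>: "lower_order \<phi> = ereal l"
proof (rule antisym)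
  let ?X = "\<lambda>n. ereal (ln (real n) / - ln (\<phi> n))" and ?Y = "\<lambda>n. ereal (ln (real n) / - ln (\<psi> n))"
  have Y: "?Y \<longlonglongrightarrow> ereal l" using \<psi>_order by simp
  have "\<forall>\<^sub>F n in sequentially. ?Y n \<le> ?X n"
    using eventually_\<phi>_less_1
  proof eventually_elim
    case (elim n)
    have "ln (\<psi> n) \<le> ln (\<phi> n)" "ln (\<phi> n) < 0"
      using elim \<psi>_pos[of n] \<psi>_le_\<phi>[of n] \<phi>_pos[of n] by simp_all
    then have "ln (real n) / - ln (\<psi> n) \<le> ln (real n) / - ln (\<phi> n)"
      using elim by (intro divide_left_mono) (auto intro!: mult_neg_neg)
    then show ?case by simp
  qed
  then have "liminf ?Y \<le> liminf ?X" by (rule Liminf_mono)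
  then show "ereal l \<le> lower_order \<phi>"
    using lim_imp_Liminf[OF sequentially_bot Y] by (simp add: lower_order_def)
  have "liminf ?X \<le> liminf (?X \<circ> (\<lambda>j. N j + 1))"
    by (rule liminf_subseq_mono[OF strict_mono_Suc_N])
  also have "?X \<circ> (\<lambda>j. N j + 1) = ?Y \<circ> (\<lambda>j. N j + 1)"
    by (simp only: o_def \<phi>_Suc_N)
  also have "liminf \<dots> = ereal l"
    using LIMSEQ_subseq_LIMSEQ[OF Y strict_mono_Suc_N] by (intro lim_imp_Liminf) simp_all
  finally show "lower_order \<phi> \<le> ereal l" by (simp add: lower_order_def)
qed

text \<open>The upper order is attained along \<open>N j\<close>, where \<open>\<phi> \<ge> r j\<close>.\<close>

lemma upper_order_\<phi>: "upper_order \<phi> = ereal u"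
proof (rule antisym)
  let ?X = "\<lambda>n. ereal (ln (real n) / - ln (\<phi> n))" and ?Y = "\<lambda>n. ln (real n) / - ln (\<psi> n)"
  have "\<forall>\<^sub>F n in sequentially. ?X n \<le> ereal (max u (?Y n))"
    using eventually_\<phi>_less_1
  proof eventually_elim
    case (elim n)
    show ?case
    proof (cases "\<phi> n = \<psi> n")
      case True
      then show ?thesis by simp
    next
      case False
      then have \<phi>n: "\<phi> n = r (step n)" by (simp add: \<phi>_def max_def split: if_splits)
      have "real n \<le> r (step n) powr - u"
        using le_N_step[of n] N_le[of "step n"] by linarith
      then have "ln (real n) \<le> ln (r (step n) powr - u)"
        using elim by (intro ln_mono) auto
      also have "\<dots> = u * - ln (\<phi> n)"
        using r_pos[of "step n"] by (simp add: ln_powr \<phi>n)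
      finally have "ln (real n) / - ln (\<phi> n) \<le> u"
        using elim \<phi>_pos[of n] by (simp add: field_simps)
      then show ?thesis by (simp add: le_max_iff_disj)
    qed
  qed
  then have "limsup ?X \<le> limsup (\<lambda>n. ereal (max u (?Y n)))" by (rule Limsup_mono)
  also have "\<dots> = ereal (max u l)"
    by (intro lim_imp_Limsup tendsto_ereal tendsto_max tendsto_const \<psi>_order) simp
  finally show "upper_order \<phi> \<le> ereal u" using l_less_u by (simp add: upper_order_def)

  have ln_r: "filterlim (\<lambda>j. - ln (r j)) at_top sequentially"
  proof -
    have "filterlim r (at_right 0) sequentially"
      by (simp add: filterlim_at r_lim r_pos always_eventually less_imp_neq[OF r_pos, symmetric])
    then have "filterlim (\<lambda>j. ln (r j)) at_bot sequentially"
      by (rule filterlim_compose[OF ln_at_0])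
    then show ?thesis by (simp add: filterlim_uminus_at_top)
  qed
  have "(\<lambda>j. u - ln 2 / - ln (r j)) \<longlonglongrightarrow> u - 0"
    by (intro tendsto_diff tendsto_const tendsto_divide_0[OF tendsto_const] filterlim_at_top_imp_at_infinity[OF ln_r])
  then have "(\<lambda>j. ereal (u - ln 2 / - ln (r j))) \<longlonglongrightarrow> ereal u" by simp
  from lim_imp_Limsup[OF sequentially_bot this]
  have "ereal u = limsup (\<lambda>j. ereal (u - ln 2 / - ln (r j)))" by simp
  also have "\<dots> \<le> limsup (?X \<circ> N)"
  proof (rule Limsup_mono)
    have "\<forall>\<^sub>F j in sequentially. 1 \<le> N j \<and> \<phi> (N j) < 1"
      by (rule eventually_compose_filterlim[OF eventually_\<phi>_less_1 filterlim_subseq[OF N_strict]])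
    then show "\<forall>\<^sub>F j in sequentially. ereal (u - ln 2 / - ln (r j)) \<le> (?X \<circ> N) j"
    proof eventually_elim
      case (elim j)
      have "r j powr - u \<le> 2 * real (N j)" using N_ge[of j] elim by linarith
      then have "ln (r j powr - u) \<le> ln (2 * real (N j))"
        using r_pos[of j] by (intro ln_mono) auto
      then have ln_N: "u * - ln (r j) - ln 2 \<le> ln (real (N j))"
        using r_pos[of j] elim by (simp add: ln_powr ln_mult)
      have \<phi>N: "ln (r j) \<le> ln (\<phi> (N j))" "ln (\<phi> (N j)) < 0"
        using r_le_\<phi>[of "N j" j] r_pos[of j] \<phi>_pos[of "N j"] elim by simp_all
      then have neg: "ln (r j) < 0" by linarith
      have "u - ln 2 / - ln (r j) = (u * - ln (r j) - ln 2) / - ln (r j)"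
        using neg by (simp add: field_simps)
      also have "\<dots> \<le> ln (real (N j)) / - ln (r j)"
        using ln_N neg by (intro divide_right_mono) auto
      also have "\<dots> \<le> ln (real (N j)) / - ln (\<phi> (N j))"
        using elim \<phi>N neg by (intro divide_left_mono) (auto intro!: mult_neg_neg)
      finally show ?case by simp
    qed
  qed
  also have "\<dots> \<le> limsup ?X" by (rule limsup_subseq_mono[OF N_strict])
  finally show "ereal u \<le> upper_order \<phi>" by (simp add: upper_order_def)
qed

text \<open>
  When \<open>p j / q j\<close> approximates \<open>\<alpha>\<close> to within \<open>r j powr (1 + u)\<close>, the first \<open>N j\<close> multiples of \<open>\<alpha>\<close>
  stay within \<open>r j\<close> of the fractions with denominator \<open>q j\<close>. So the raised part of \<open>\<phi>\<close> costs only
  \<open>q j\<close> intervals of radius \<open>2 * r j\<close> per unit length.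
\<close>

lemma hausdorff_measure_inhom_approx_set_\<phi>:
  fixes p :: "nat \<Rightarrow> int" and q :: "nat \<Rightarrow> nat"
  assumes s: "0 < s" and q: "\<And>j. 1 \<le> q j"
    and approx: "\<And>j. \<bar>\<alpha> - p j / q j\<bar> \<le> r j powr (1 + u)"
    and sum\<psi>: "summable (\<lambda>n. \<psi> n powr s)"
    and sumr: "summable (\<lambda>j. real (q j) * r j powr s)"
  shows "hausdorff_measure s (inhom_approx_set \<phi> \<alpha>) = 0"
proof -
  \<comment> \<open>The value of \<open>\<psi>\<close> at \<open>0\<close> is arbitrary, hence the shift.\<close>
  define S1 where "S1 = {y. infinite {n. \<exists>m::int. \<bar>y - (real (Suc n) * \<alpha> + m / real 1)\<bar> < \<psi> (Suc n)}}"
  define S2 where "S2 = {y. infinite {j. \<exists>m::int. \<bar>y - (0 + m / real (q j))\<bar> < 2 * r j}}"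
  have "hausdorff_measure s S1 = 0"
    unfolding S1_def
  proof (rule hausdorff_measure_limsup_eq_0[OF s])
    show "(\<lambda>n. \<psi> (Suc n)) \<longlonglongrightarrow> 0" using \<psi>_lim by (rule LIMSEQ_Suc)
    show "summable (\<lambda>n. real 1 * \<psi> (Suc n) powr s)"
      using sum\<psi> summable_Suc_iff[of "\<lambda>n. \<psi> n powr s"] by simp
  qed (use \<psi>_pos in \<open>auto simp: less_imp_le\<close>)
  moreover have "hausdorff_measure s S2 = 0"
    unfolding S2_def
  proof (rule hausdorff_measure_limsup_eq_0[OF s q])
    show "(\<lambda>j. 2 * r j) \<longlonglongrightarrow> 0" using tendsto_mult_left[OF r_lim, of 2] by simp
    have "summable (\<lambda>j. 2 powr s * (real (q j) * r j powr s))"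
      using sumr by (rule summable_mult)
    then show "summable (\<lambda>j. real (q j) * (2 * r j) powr s)"
      using r_pos by (simp add: powr_mult less_imp_le mult_ac)
  qed (use r_pos in \<open>auto simp: less_imp_le\<close>)
  ultimately have "hausdorff_measure s (\<Union>i::nat. if i = 0 then S1 else S2) = 0"
    by (intro hausdorff_measure_UN_eq_0[OF s]) simp
  moreover have "inhom_approx_set \<phi> \<alpha> \<subseteq> (\<Union>i::nat. if i = 0 then S1 else S2)"
  proof
    fix y assume "y \<in> inhom_approx_set \<phi> \<alpha>"
    then have inf: "infinite {n. 1 \<le> n \<and> dist_nearest_int (real n * \<alpha> - y) < \<phi> n}"
      by (simp add: inhom_approx_set_def)
    define A where "A = {n. 1 \<le> n \<and> dist_nearest_int (real n * \<alpha> - y) < \<psi> n}"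
    define B where "B = {n. 1 \<le> n \<and> dist_nearest_int (real n * \<alpha> - y) < r (step n)}"
    have "{n. 1 \<le> n \<and> dist_nearest_int (real n * \<alpha> - y) < \<phi> n} \<subseteq> A \<union> B"
      by (auto simp: A_def B_def \<phi>_def less_max_iff_disj)
    then have "infinite A \<or> infinite B" using inf by (metis finite_Un finite_subset)
    then show "y \<in> (\<Union>i::nat. if i = 0 then S1 else S2)"
    proof
      assume A: "infinite A"
      have "A \<subseteq> Suc ` {n. \<exists>m::int. \<bar>y - (real (Suc n) * \<alpha> + m / real 1)\<bar> < \<psi> (Suc n)}"
      proof
        fix n assume "n \<in> A"
        then have n: "1 \<le> n" "dist_nearest_int (real n * \<alpha> - y) < \<psi> n" by (auto simp: A_def)
        obtain k where k: "n = Suc k" using n(1) by (cases n) auto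
        obtain m :: int where "dist_nearest_int (real n * \<alpha> - y) = \<bar>real n * \<alpha> - y - m\<bar>"
          using dist_nearest_int_attained by blast
        also have "\<dots> = \<bar>y - (real (Suc k) * \<alpha> + real_of_int (- m) / real 1)\<bar>" by (simp add: k)
        finally have "\<bar>y - (real (Suc k) * \<alpha> + real_of_int (- m) / real 1)\<bar> < \<psi> (Suc k)" using n(2) k by simp
        then show "n \<in> Suc ` {n. \<exists>m::int. \<bar>y - (real (Suc n) * \<alpha> + m / real 1)\<bar> < \<psi> (Suc n)}"
          unfolding k by blast
      qed
      then have "y \<in> S1" using A unfolding S1_def by (auto dest: finite_subset)
      then show ?thesis by (intro UN_I[of 0]) auto
    next
      assume B: "infinite B"
      let ?J = "{j. \<exists>m::int. \<bar>y - (0 + m / real (q j))\<bar> < 2 * r j}"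
      have "B \<subseteq> (\<Union>j\<in>?J. {..N j})"
      proof
        fix n assume "n \<in> B"
        then have n: "1 \<le> n" "dist_nearest_int (real n * \<alpha> - y) < r (step n)" by (auto simp: B_def)
        define j where "j = step n"
        have qj: "real (q j) > 0" using q[of j] by simp
        obtain m :: int where "dist_nearest_int (real n * \<alpha> - y) = \<bar>real n * \<alpha> - y - m\<bar>"
          using dist_nearest_int_attained by blast
        then have m: "\<bar>real n * \<alpha> - y - m\<bar> < r j" using n(2) by (simp add: j_def)
        have "real n \<le> real (N j)" using le_N_step[of n] by (simp add: j_def)
        then have "\<bar>real n * (\<alpha> - p j / q j)\<bar> \<le> r j powr - u * r j powr (1 + u)"
          unfolding abs_mult using N_le[of j] approx[of j] by (intro mult_mono) auto
        also have "\<dots> = r j" using r_pos[of j] by (simp flip: powr_add)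
        finally have near: "\<bar>real n * (\<alpha> - p j / q j)\<bar> \<le> r j" .
        define z where "z = real_of_int (int n * p j - m * int (q j)) / real (q j)"
        have yz: "y - z = real n * (\<alpha> - p j / q j) - (real n * \<alpha> - y - m)"
          using qj by (simp add: z_def field_simps)
        have "\<bar>y - z\<bar> \<le> \<bar>real n * (\<alpha> - p j / q j)\<bar> + \<bar>real n * \<alpha> - y - m\<bar>"
          unfolding yz by (rule abs_triangle_ineq4)
        also have "\<dots> < r j + r j" using near m by (rule add_le_less_mono)
        finally have "\<bar>y - (0 + z)\<bar> < 2 * r j" by simp
        then have "j \<in> ?J" unfolding z_def by blast
        then show "n \<in> (\<Union>j\<in>?J. {..N j})" using le_N_step[of n] by (auto simp: j_def)
      qed
      then have "infinite ?J" using B by (auto dest: finite_subset)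
      then have "y \<in> S2" by (simp add: S2_def)
      then show ?thesis by (intro UN_I[of 1]) auto
    qed
  qed
  ultimately show ?thesis
    using hausdorff_measure_mono[of "inhom_approx_set \<phi> \<alpha>" "\<Union>i::nat. if i = 0 then S1 else S2" s] by simp
qed

end

section \<open>The construction\<close>

text \<open>A function of order \<open>l\<close>; for \<open>l = 0\<close> it has to decay faster than every power.\<close>

definition order_function :: "real \<Rightarrow> nat \<Rightarrow> real" where
  "order_function l n = (if l = 0 then exp (- real n) else real n powr (- 1 / l))"

lemma order_function_pos: "1 \<le> n \<Longrightarrow> 0 < order_function l n"
  by (simp add: order_function_def)

lemma order_function_mono:
  assumes "0 \<le> l" "1 \<le> m" "m \<le> n"
  shows "order_function l n \<le> order_function l m"
  using assms by (auto simp: order_function_def intro!: powr_mono2')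

lemma order_function_lim:
  assumes "0 \<le> l"
  shows "order_function l \<longlonglongrightarrow> 0"
proof (cases "l = 0")
  case True
  have "(\<lambda>n. exp (- real n)) \<longlonglongrightarrow> 0" by real_asymp
  then show ?thesis using True by (simp add: order_function_def[abs_def])
next
  case False
  then have "- 1 / l < 0" using assms by simp
  then have "(\<lambda>n. real n powr (- 1 / l)) \<longlonglongrightarrow> 0" by real_asymp
  then show ?thesis using False by (simp add: order_function_def[abs_def])
qed

lemma order_function_order:
  assumes "0 \<le> l"
  shows "(\<lambda>n. ln (real n) / - ln (order_function l n)) \<longlonglongrightarrow> l"
proof (cases "l = 0")
  case True
  have "(\<lambda>n. ln (real n) / real n) \<longlonglongrightarrow> 0" by real_asymp
  then show ?thesis using True by (simp add: order_function_def)
next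
  case False
  have "\<forall>\<^sub>F n in sequentially. ln (real n) / - ln (order_function l n) = l"
    using eventually_ge_at_top[of 2]
  proof eventually_elim
    case (elim n)
    then have "ln (real n) > 0" by simp
    then show ?case using False elim by (simp add: order_function_def ln_powr)
  qed
  then show ?thesis by (rule tendsto_eventually)
qed

lemma summable_order_function:
  assumes "0 \<le> l" "l < s"
  shows "summable (\<lambda>n. order_function l n powr s)"
proof (cases "l = 0")
  case True
  have "order_function l n powr s = exp (- s) ^ n" for n
    using True by (simp add: order_function_def powr_def mult.commute flip: exp_of_nat_mult)
  then show ?thesis using assms True by (simp add: summable_geometric)
next
  case False
  then have "- 1 / l * s < - 1" using assms by (simp add: field_simps)
  then show ?thesis using False by (simp add: order_function_def powr_powr summable_real_powr_iff)
qed

text \<open>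
  The exponent \<open>S = (1 + u) / (1 + \<beta>)\<close>, which is \<open>0\<close> for infinite \<open>\<beta>\<close>, as a real number.
  Comparing a number with \<open>S\<close> amounts to comparing the corresponding approximation exponent
  with \<open>\<beta>\<close>.
\<close>

lemma exponent_of_type:
  fixes u :: real and \<beta> :: ereal
  assumes \<beta>: "1 \<le> \<beta>" and u: "ereal u > 1 / \<beta>"
  shows "\<exists>S. ereal S = ereal (1 + u) / (1 + \<beta>) \<and> 0 < u \<and> 0 \<le> S \<and> S < u
    \<and> (\<forall>\<sigma>>S. ereal ((1 + u) / \<sigma> - 1) < \<beta>)
    \<and> (\<forall>t. 0 < t \<longrightarrow> t < S \<longrightarrow> \<beta> < ereal ((1 + u) / t - 1))"
proof (cases \<beta>)
  case PInf
  then show ?thesis using u by (intro exI[of _ 0]) (auto simp: zero_ereal_def)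
next
  case (real b)
  then have b: "1 \<le> b" using \<beta> by (simp add: one_ereal_def)
  then have ub: "1 / b < u" using u real by (simp add: one_ereal_def)
  have "0 < 1 / b" using b by simp
  then have "0 < u" using ub by linarith
  have "1 < u * b" using ub b by (simp add: field_simps)
  show ?thesis
  proof (intro exI[of _ "(1 + u) / (1 + b)"] conjI allI impI)
    show "ereal ((1 + u) / (1 + b)) = ereal (1 + u) / (1 + \<beta>)"
      using real b by (simp add: one_ereal_def)
    show "(1 + u) / (1 + b) < u" using b \<open>1 < u * b\<close> by (simp add: field_simps)
    show "0 \<le> (1 + u) / (1 + b)" using b \<open>0 < u\<close> by simp
    show "0 < u" by fact
    show "ereal ((1 + u) / \<sigma> - 1) < \<beta>" if "(1 + u) / (1 + b) < \<sigma>" for \<sigma>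
    proof -
      have "0 < (1 + u) / (1 + b)" using b \<open>0 < u\<close> by simp
      then have "\<sigma> > 0" using that by linarith
      then show ?thesis using that b real by (simp add: field_simps)
    qed
    show "\<beta> < ereal ((1 + u) / t - 1)" if "0 < t" "t < (1 + u) / (1 + b)" for t
      using that b real by (simp add: field_simps)
  qed
qed (use \<beta> in auto)

text \<open>
  The radius \<open>r\<close> attached to the fraction \<open>p / q\<close>. It is chosen so that \<open>r powr (- u)\<close> consecutive
  multiples of \<open>\<alpha>\<close> drift away from the multiples of \<open>p / q\<close> by no more than \<open>r\<close>.
\<close>

definition fraction_radius :: "real \<Rightarrow> real \<Rightarrow> nat \<times> int \<Rightarrow> real" where
  "fraction_radius \<alpha> u = (\<lambda>(q, p). \<bar>\<alpha> - p / q\<bar> powr (1 / (1 + u)))"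

text \<open>
  For every \<open>\<sigma> > (1 + u) / (1 + \<beta>)\<close> there are arbitrarily large denominators that are at most
  \<open>r powr (- \<sigma>)\<close> for the attached radius \<open>r\<close>.
\<close>

lemma good_fractions:
  fixes \<alpha> u :: real
  assumes \<alpha>: "\<alpha> \<notin> \<rat>" and u: "0 < u" "u \<le> 1" and \<sigma>: "0 < \<sigma>"
    and type: "ereal ((1 + u) / \<sigma> - 1) < diophantine_type \<alpha>"
  shows "\<exists>q p. R \<le> q \<and> 1 \<le> q \<and> coprime p (int q) \<and> \<bar>\<alpha> - real_of_int p / real q\<bar> < 1 / real q ^ 2
    \<and> 0 < fraction_radius \<alpha> u (q, p) \<and> fraction_radius \<alpha> u (q, p) \<le> 1 / real q
    \<and> real q * fraction_radius \<alpha> u (q, p) powr \<sigma> \<le> 1"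
proof -
  define \<theta> where "\<theta> = max 1 ((1 + u) / \<sigma> - 1)"
  have "\<theta> = 1 \<or> (1 \<le> \<theta> \<and> ereal \<theta> < diophantine_type \<alpha>)"
    using type by (auto simp: \<theta>_def max_def)
  from approximations_below_diophantine_type[OF \<alpha> this, of R]
  obtain q p where q: "R \<le> q" "1 \<le> q" and cop: "coprime p (int q)"
    and qp: "\<bar>real q * \<alpha> - real_of_int p\<bar> < real q powr - \<theta>"
    by blast
  define \<epsilon> where "\<epsilon> = \<bar>\<alpha> - p / q\<bar>"
  have "\<alpha> \<noteq> p / q" using \<alpha> by (metis Rats_divide Rats_of_int Rats_of_nat)
  then have \<epsilon>0: "\<epsilon> > 0" by (simp add: \<epsilon>_def)
  have "\<epsilon> = \<bar>real q * \<alpha> - p\<bar> / q"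
  proof -
    have "\<alpha> - p / q = (real q * \<alpha> - p) / q" using q by (simp add: field_simps)
    then show ?thesis by (simp add: \<epsilon>_def abs_divide)
  qed
  also have "\<dots> < real q powr - \<theta> / q"
    using qp q by (intro divide_strict_right_mono) auto
  also have "\<dots> = real q powr (- \<theta> - 1)"
    using q by (simp add: powr_diff)
  finally have \<epsilon>: "\<epsilon> < real q powr (- \<theta> - 1)" .
  have "real q powr (- \<theta> - 1) \<le> real q powr (- 2)"
    using q by (intro powr_mono) (auto simp: \<theta>_def)
  also have "\<dots> = 1 / real q ^ 2" using q by (simp add: powr_minus_divide)
  finally have \<epsilon>2: "\<epsilon> < 1 / real q ^ 2" using \<epsilon> by simp
  have "(1 + u) / \<sigma> - 1 \<le> \<theta>" by (simp add: \<theta>_def)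
  moreover have "- (1 + u) / \<sigma> = - ((1 + u) / \<sigma>)" by (rule minus_divide_left[symmetric])
  ultimately have "- \<theta> - 1 \<le> - (1 + u) / \<sigma>" by linarith
  then have "real q powr (- \<theta> - 1) \<le> real q powr (- (1 + u) / \<sigma>)"
    using q by (intro powr_mono) auto
  then have \<epsilon>\<sigma>: "\<epsilon> \<le> real q powr (- (1 + u) / \<sigma>)" using \<epsilon> by simp
  have rad: "fraction_radius \<alpha> u (q, p) = \<epsilon> powr (1 / (1 + u))"
    by (simp add: fraction_radius_def \<epsilon>_def)
  have "\<epsilon> powr (1 / (1 + u)) \<le> (real q powr (- (1 + u))) powr (1 / (1 + u))"
  proof (rule powr_mono2)
    have "real q powr (- 2) \<le> real q powr (- (1 + u))"
      using q u by (intro powr_mono) auto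
    then show "\<epsilon> \<le> real q powr (- (1 + u))"
      using \<epsilon>2 q by (simp add: powr_minus_divide)
  qed (use u \<epsilon>0 in auto)
  also have "\<dots> = real q powr (- (1 + u) * (1 / (1 + u)))" by (rule powr_powr)
  also have "- (1 + u) * (1 / (1 + u)) = - 1" using u by (simp add: field_simps)
  finally have r1: "fraction_radius \<alpha> u (q, p) \<le> 1 / real q"
    using q by (simp add: rad powr_minus_divide)
  have "fraction_radius \<alpha> u (q, p) powr \<sigma> = \<epsilon> powr (\<sigma> / (1 + u))"
    by (simp add: rad powr_powr)
  also have "\<dots> \<le> (real q powr (- (1 + u) / \<sigma>)) powr (\<sigma> / (1 + u))"
    using \<epsilon>\<sigma> \<epsilon>0 \<sigma> u by (intro powr_mono2) auto
  also have "\<dots> = real q powr (- (1 + u) / \<sigma> * (\<sigma> / (1 + u)))" by (rule powr_powr)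
  also have "- (1 + u) / \<sigma> * (\<sigma> / (1 + u)) = - ((1 + u) / \<sigma> * (\<sigma> / (1 + u)))"
    by (simp only: minus_divide_left mult_minus_left)
  also have "(1 + u) / \<sigma> * (\<sigma> / (1 + u)) = 1" using \<sigma> u by simp
  finally have "real q * fraction_radius \<alpha> u (q, p) powr \<sigma> \<le> 1"
    using q by (simp add: powr_minus_divide field_simps)
  then show ?thesis
    using q cop \<epsilon>2 \<epsilon>0 r1 by (intro exI[of _ q] exI[of _ p]) (simp add: \<epsilon>_def rad)
qed

text \<open>
  The last index at which the radius attached to the fraction \<open>p / q\<close> is used.
\<close>

definition fraction_length :: "real \<Rightarrow> real \<Rightarrow> nat \<times> int \<Rightarrow> nat" where
  "fraction_length \<alpha> u x = nat \<lfloor>fraction_radius \<alpha> u x powr - u\<rfloor>"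

text \<open>
  The sequence of fractions. The exponents \<open>S + 1 / (j + 1)\<close> decrease to \<open>S\<close>, so that the
  denominators are eventually at most \<open>r j powr (- \<sigma>)\<close> for every \<open>\<sigma> > S\<close>.
\<close>

lemma sparse_fractions:
  fixes \<alpha> u :: real and \<psi> :: "nat \<Rightarrow> real"
  assumes \<alpha>: "\<alpha> \<notin> \<rat>" and u: "0 < u" "u \<le> 1" and S: "0 \<le> S"
    and type: "\<forall>\<sigma>>S. ereal ((1 + u) / \<sigma> - 1) < diophantine_type \<alpha>"
    and \<psi>: "\<forall>n\<ge>1. 0 < \<psi> n"
  shows "\<exists>(q :: nat \<Rightarrow> nat) (p :: nat \<Rightarrow> int) (r :: nat \<Rightarrow> real) (N :: nat \<Rightarrow> nat). \<forall>j.
    2 ^ j \<le> q j \<and> coprime (p j) (int (q j)) \<and>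
    \<bar>\<alpha> - real_of_int (p j) / real (q j)\<bar> < 1 / real (q j) ^ 2 \<and>
    r j = \<bar>\<alpha> - real_of_int (p j) / real (q j)\<bar> powr (1 / (1 + u)) \<and>
    0 < r j \<and> r j \<le> 1 / real (q j) \<and> real (q j) * r j powr (S + 1 / real (Suc j)) \<le> 1 \<and>
    real (N j) \<le> r j powr - u \<and> r j powr - u < real (N j) + 1 \<and>
    N j < N (Suc j) \<and> r (Suc j) \<le> r j \<and> r (Suc j) \<le> \<psi> (N j + 1)"
proof -
  let ?r = "fraction_radius \<alpha> u" and ?N = "fraction_length \<alpha> u"
  define P where "P = (\<lambda>j (q::nat, p::int). 2 ^ j \<le> q \<and> coprime p (int q)
    \<and> \<bar>\<alpha> - real_of_int p / real q\<bar> < 1 / real q ^ 2 \<and> 0 < ?r (q, p) \<and> ?r (q, p) \<le> 1 / real q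
    \<and> real q * ?r (q, p) powr (S + 1 / real (Suc j)) \<le> 1)"
  define Q where "Q = (\<lambda>x y. ?N x < ?N y \<and> ?r y \<le> ?r x \<and> ?r y \<le> \<psi> (?N x + 1))"
  have ex: "\<exists>q p. R \<le> q \<and> 1 \<le> q \<and> P j (q, p)" for R j
  proof -
    have "0 < S + 1 / real (Suc j)" using S by (simp add: add_nonneg_pos)
    moreover have "ereal ((1 + u) / (S + 1 / real (Suc j)) - 1) < diophantine_type \<alpha>"
      using type by simp
    ultimately obtain q p where
      "max R (2 ^ j) \<le> q" "1 \<le> q" "coprime p (int q)" "\<bar>\<alpha> - real_of_int p / real q\<bar> < 1 / real q ^ 2"
      "0 < ?r (q, p)" "?r (q, p) \<le> 1 / real q" "real q * ?r (q, p) powr (S + 1 / real (Suc j)) \<le> 1"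
      using good_fractions[OF \<alpha> u, of "S + 1 / real (Suc j)" "max R (2 ^ j)"] by blast
    then show ?thesis unfolding P_def by (intro exI[of _ q] exI[of _ p]) simp
  qed
  have "\<exists>f. \<forall>j. P j (f j) \<and> Q (f j) (f (Suc j))"
  proof (rule dependent_nat_choice)
    show "\<exists>x. P 0 x" using ex by blast
  next
    fix x j assume x: "P j x"
    have rx: "?r x > 0" using x by (auto simp: P_def split: prod.splits)
    define e where "e = min (?r x) (\<psi> (?N x + 1))"
    have e: "e > 0" using rx \<psi>[rule_format, of "?N x + 1"] by (simp add: e_def)
    have "filterlim (\<lambda>q. real q powr u) at_top sequentially" using u by real_asymp
    then have "\<forall>\<^sub>F q in sequentially. real (?N x + 1) \<le> real q powr u"
      by (simp add: filterlim_at_top)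
    then obtain R where R: "\<And>q. R \<le> q \<Longrightarrow> real (?N x + 1) \<le> real q powr u"
      by (auto simp: eventually_sequentially)
    obtain q p where q: "max R (nat \<lceil>1 / e\<rceil>) \<le> q" "1 \<le> q" "P (Suc j) (q, p)" using ex by blast
    have "1 / e \<le> real q" using q(1) by linarith
    then have "1 / real q \<le> e" using e q(2) by (simp add: field_simps)
    moreover have ry: "0 < ?r (q, p)" "?r (q, p) \<le> 1 / real q" using q(3) by (simp_all add: P_def)
    ultimately have "?r (q, p) \<le> e" by simp
    have "real (?N x + 1) \<le> real q powr u" using R q(1) by simp
    also have "\<dots> = (1 / real q) powr - u" using q(2) by (simp add: powr_minus_divide powr_divide)
    also have "\<dots> \<le> ?r (q, p) powr - u" using ry u by (intro powr_mono2') auto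
    finally have "?N x < ?N (q, p)" unfolding fraction_length_def[of _ _ "(q, p)"] by linarith
    then show "\<exists>y. P (Suc j) y \<and> Q x y"
      using q(3) \<open>?r (q, p) \<le> e\<close> by (intro exI[of _ "(q, p)"]) (simp add: Q_def e_def)
  qed
  then obtain f where f: "\<And>j. P j (f j)" "\<And>j. Q (f j) (f (Suc j))" by blast
  define q where "q = (\<lambda>j. fst (f j))"
  define p where "p = (\<lambda>j. snd (f j))"
  have feq: "f j = (q j, p j)" for j by (simp add: q_def p_def)
  have P: "2 ^ j \<le> q j" "coprime (p j) (int (q j))" "\<bar>\<alpha> - p j / q j\<bar> < 1 / real (q j) ^ 2"
      "0 < ?r (f j)" "?r (f j) \<le> 1 / q j" "real (q j) * ?r (f j) powr (S + 1 / real (Suc j)) \<le> 1"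
    for j using f(1)[of j] by (simp_all add: P_def feq)
  have Q: "?N (f j) < ?N (f (Suc j))" "?r (f (Suc j)) \<le> ?r (f j)" "?r (f (Suc j)) \<le> \<psi> (?N (f j) + 1)"
    for j using f(2)[of j] by (simp_all add: Q_def)
  have N: "real (?N x) \<le> ?r x powr - u" "?r x powr - u < real (?N x) + 1" for x
    unfolding fraction_length_def using powr_ge_zero[of "?r x" "- u"] by linarith+
  have r: "?r (f j) = \<bar>\<alpha> - real_of_int (p j) / real (q j)\<bar> powr (1 / (1 + u))" for j
    by (simp add: fraction_radius_def feq)
  show ?thesis
    by (rule exI[of _ q], rule exI[of _ p], rule exI[of _ "\<lambda>j. ?r (f j)"], rule exI[of _ "\<lambda>j. ?N (f j)"],
        intro allI conjI P Q N r)
qed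

theorem theorem1p5:
  fixes \<alpha> l u :: real
  assumes "\<alpha> \<notin> \<rat>"
    and "0 \<le> l" and "l < u" and "u \<le> 1"
    and "ereal u > 1 / diophantine_type \<alpha>"
  shows "\<exists>\<phi> :: nat \<Rightarrow> real. decreasing_to_zero \<phi>
      \<and> lower_order \<phi> = ereal l \<and> upper_order \<phi> = ereal u
      \<and> hausdorff_dim (inhom_approx_set \<phi> \<alpha>)
          = max (ereal l) (ereal (1 + u) / (1 + diophantine_type \<alpha>))
      \<and> max (ereal l) (ereal (1 + u) / (1 + diophantine_type \<alpha>)) < ereal u"
proof -
  obtain S where S: "ereal S = ereal (1 + u) / (1 + diophantine_type \<alpha>)"
    and u0: "0 < u" and S0: "0 \<le> S" and Su: "S < u"
    and type_above: "\<forall>\<sigma>>S. ereal ((1 + u) / \<sigma> - 1) < diophantine_type \<alpha>"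
    and type_below: "\<And>t. 0 < t \<Longrightarrow> t < S \<Longrightarrow> diophantine_type \<alpha> < ereal ((1 + u) / t - 1)"
    using exponent_of_type[OF one_le_diophantine_type assms(5)] by auto
  define \<psi> where "\<psi> = order_function l"
  have \<psi>_pos: "\<forall>n\<ge>1. 0 < \<psi> n" by (simp add: \<psi>_def order_function_pos)
  from sparse_fractions[OF assms(1) u0 assms(4) S0 type_above \<psi>_pos]
  obtain q p r N where fractions: "\<forall>j. 2 ^ j \<le> q j \<and> coprime (p j) (int (q j)) \<and>
    \<bar>\<alpha> - real_of_int (p j) / real (q j)\<bar> < 1 / real (q j) ^ 2 \<and>
    r j = \<bar>\<alpha> - real_of_int (p j) / real (q j)\<bar> powr (1 / (1 + u)) \<and>
    0 < r j \<and> r j \<le> 1 / real (q j) \<and> real (q j) * r j powr (S + 1 / real (Suc j)) \<le> 1 \<and>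
    real (N j) \<le> r j powr - u \<and> r j powr - u < real (N j) + 1 \<and>
    N j < N (Suc j) \<and> r (Suc j) \<le> r j \<and> r (Suc j) \<le> \<psi> (N j + 1)"
    by (elim exE)
  then have q: "\<And>j. 2 ^ j \<le> q j" and cop: "\<And>j. coprime (p j) (int (q j))"
    and approx: "\<And>j. \<bar>\<alpha> - real_of_int (p j) / real (q j)\<bar> < 1 / real (q j) ^ 2"
    and r: "\<And>j. r j = \<bar>\<alpha> - real_of_int (p j) / real (q j)\<bar> powr (1 / (1 + u))"
    and r0: "\<And>j. 0 < r j" and r1: "\<And>j. r j \<le> 1 / real (q j)"
    and qr: "\<And>j. real (q j) * r j powr (S + 1 / real (Suc j)) \<le> 1"
    and N_le: "\<And>j. real (N j) \<le> r j powr - u" and N_ge: "\<And>j. r j powr - u < real (N j) + 1"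
    and N_Suc: "\<And>j. N j < N (Suc j)" and r_Suc: "\<And>j. r (Suc j) \<le> r j"
    and sparse: "\<And>j. r (Suc j) \<le> \<psi> (N j + 1)"
    by iprover+
  have q1: "1 \<le> q j" for j using q[of j] by (metis one_le_numeral one_le_power order_trans)
  have r_pow: "r j \<le> (1/2) ^ j" for j
  proof -
    have "2 ^ j \<le> real (q j)" using q[of j] by (metis of_nat_mono of_nat_numeral of_nat_power)
    then have "1 / real (q j) \<le> 1 / 2 ^ j" by (intro frac_le) auto
    then show ?thesis using r1[of j] by (simp add: power_one_over)
  qed
  have r_lim: "r \<longlonglongrightarrow> 0"
    by (rule tendsto_sandwich[OF _ _ tendsto_const LIMSEQ_power_zero[of "1/2::real"]])
       (use r0 r_pow in \<open>auto simp: less_imp_le\<close>)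
  interpret raised_approximation \<psi> r N l u
  proof
    show "r j \<le> r i" if "i \<le> j" for i j using lift_Suc_antimono_le[of r, OF r_Suc that] .
    show "(\<lambda>n. ln (real n) / - ln (\<psi> n)) \<longlonglongrightarrow> l"
      unfolding \<psi>_def by (rule order_function_order[OF assms(2)])
    show "strict_mono N" using N_Suc by (simp add: strict_mono_Suc_iff)
  qed (use assms \<psi>_pos r0 r_lim N_le N_ge sparse in
      \<open>auto simp: \<psi>_def intro: order_function_mono order_function_lim\<close>)
  let ?E = "inhom_approx_set \<phi> \<alpha>"

  have "hausdorff_dim ?E \<le> ereal (max l S)"
  proof (rule hausdorff_dim_leI)
    fix s assume "max l S < s"
    then have ls: "l < s" and Ss: "S < s" by auto
    show "hausdorff_measure s ?E = 0"
    proof (rule hausdorff_measure_inhom_approx_set_\<phi>[OF _ q1])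
      show "0 < s" using ls assms(2) by simp
      show "summable (\<lambda>n. \<psi> n powr s)"
        unfolding \<psi>_def using assms(2) ls by (rule summable_order_function)
      show "\<bar>\<alpha> - real_of_int (p j) / real (q j)\<bar> \<le> r j powr (1 + u)" for j
        using u0 by (simp add: r powr_powr)
      \<comment> \<open>Since \<open>q j \<le> r j powr (- \<sigma>)\<close> eventually, for \<open>\<sigma> < s\<close>, the series is dominated by a
        geometric one.\<close>
      define \<sigma> where "\<sigma> = (S + s) / 2"
      have \<sigma>: "S < \<sigma>" "\<sigma> < s" using Ss by (auto simp: \<sigma>_def)
      have "(\<lambda>j. S + 1 / real (Suc j)) \<longlonglongrightarrow> S" by real_asymp
      then have "\<forall>\<^sub>F j in sequentially. S + 1 / real (Suc j) < \<sigma>"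
        using \<sigma>(1) by (rule order_tendstoD)
      then have "\<forall>\<^sub>F j in sequentially. norm (real (q j) * r j powr s) \<le> ((1/2) powr (s - \<sigma>)) ^ j"
      proof eventually_elim
        case (elim j)
        have "r j \<le> 1" using r_pow[of j] power_le_one[of "1/2::real" j] by simp
        have "real (q j) * r j powr s = real (q j) * r j powr \<sigma> * r j powr (s - \<sigma>)"
          by (simp flip: powr_add)
        also have "\<dots> \<le> real (q j) * r j powr (S + 1 / real (Suc j)) * r j powr (s - \<sigma>)"
          using elim r0[of j] \<open>r j \<le> 1\<close> by (intro mult_right_mono mult_left_mono powr_mono') auto
        also have "\<dots> \<le> 1 * r j powr (s - \<sigma>)"
          using qr[of j] by (intro mult_right_mono) auto
        also have "\<dots> \<le> ((1/2) ^ j) powr (s - \<sigma>)"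
          using r_pow[of j] r0[of j] \<sigma>(2) by (simp add: powr_mono2)
        also have "\<dots> = ((1/2) powr (s - \<sigma>)) ^ j"
          by (simp add: powr_realpow[symmetric] powr_powr mult.commute)
        finally show ?case by simp
      qed
      moreover have "summable (\<lambda>j. ((1/2) powr (s - \<sigma>)) ^ j)"
        using \<sigma>(2) by (intro summable_geometric) (simp add: powr_def ln_div mult_less_0_iff)
      ultimately show "summable (\<lambda>j. real (q j) * r j powr s)"
        by (rule summable_comparison_test_ev)
    qed
  qed (use S0 in simp)

  moreover have "ereal l \<le> hausdorff_dim ?E"
  proof (rule hausdorff_dim_geI)
    fix s assume s: "0 < s" "s < l"
    define t where "t = (s + l) / 2"
    have t: "s < t" "t < l" "t \<le> 1" using s assms by (auto simp: t_def)
    show "hausdorff_measure s ?E \<noteq> 0"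
    proof (rule hausdorff_measure_inhom_approx_set_nonzero[OF s(1) t(1,3) \<phi>_mono])
      fix R :: nat
      have "0 < 1 / t - 1 / l" using s t by (simp add: field_simps)
      then have "filterlim (\<lambda>q. real q powr (1 / t - 1 / l)) at_top sequentially" by real_asymp
      then have "\<forall>\<^sub>F q in sequentially. 2 powr (1 / l) \<le> real q powr (1 / t - 1 / l)"
        by (simp add: filterlim_at_top)
      then obtain R' where R': "\<And>q. R' \<le> q \<Longrightarrow> 2 powr (1 / l) \<le> real q powr (1 / t - 1 / l)"
        by (auto simp: eventually_sequentially)
      from approximations_below_diophantine_type[OF assms(1), of 1 "max R R'"]
      obtain k a where k: "max R R' \<le> k" "1 \<le> k" "coprime a (int k)"
        and ka: "\<bar>real k * \<alpha> - real_of_int a\<bar> < real k powr - 1"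
        by auto
      have "\<bar>\<alpha> - real_of_int a / real k\<bar> = \<bar>real k * \<alpha> - real_of_int a\<bar> / k"
      proof -
        have "\<alpha> - real_of_int a / real k = (real k * \<alpha> - real_of_int a) / k"
          using k(2) by (simp add: field_simps)
        then show ?thesis by (simp add: abs_divide)
      qed
      also have "\<dots> < real k powr - 1 / k" using ka k(2) by (intro divide_strict_right_mono) auto
      also have "\<dots> = 1 / real k ^ 2" using k(2) by (simp add: powr_minus_divide power2_eq_square)
      finally have "\<bar>\<alpha> - real_of_int a / real k\<bar> < 1 / real k ^ 2" .
      moreover have "real k powr (- 1 / t) \<le> \<phi> (2 * k)"
      proof -
        have "real k powr (- 1 / t) * 2 powr (1 / l) \<le> real k powr (- 1 / t) * real k powr (1 / t - 1 / l)"
          using R' k(1) by (intro mult_left_mono) auto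
        also have "\<dots> = real k powr (- 1 / l)" by (simp flip: powr_add)
        finally have "real k powr (- 1 / t) \<le> real k powr (- 1 / l) / 2 powr (1 / l)"
          by (simp add: field_simps)
        also have "\<dots> = \<psi> (2 * k)"
          using s t by (simp add: \<psi>_def order_function_def powr_mult powr_minus_divide)
        also have "\<dots> \<le> \<phi> (2 * k)" by (rule \<psi>_le_\<phi>)
        finally show ?thesis .
      qed
      ultimately show "\<exists>q p. R \<le> q \<and> coprime p (int q) \<and> \<bar>\<alpha> - real_of_int p / real q\<bar> < 1 / real q ^ 2
          \<and> real q powr (- 1 / t) \<le> \<phi> (2 * q)"
        using k by (intro exI[of _ k] exI[of _ a]) auto
    qed
  qed

  moreover have "ereal S \<le> hausdorff_dim ?E"
  proof (rule hausdorff_dim_geI)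
    fix s assume s: "0 < s" "s < S"
    define t where "t = (s + S) / 2"
    have t: "s < t" "t < S" "t \<le> 1" using s Su assms(4) by (auto simp: t_def)
    define t' where "t' = (t + S) / 2"
    have t': "0 < t'" "t < t'" "t' < S" using s t by (auto simp: t'_def)
    obtain c R1 where c: "c > 0"
      and R1: "\<And>n. R1 \<le> n \<Longrightarrow> c \<le> real n powr ((1 + u) / t' - 1) * dist_nearest_int (real n * \<alpha>)"
      using lower_bound_above_diophantine_type[OF type_below[OF t'(1,3)]] by blast
    show "hausdorff_measure s ?E \<noteq> 0"
    proof (rule hausdorff_measure_inhom_approx_set_nonzero[OF s(1) t(1,3) \<phi>_mono])
      fix R :: nat
      have "0 < (1 + u) / t - (1 + u) / t'"
        using s t t' u0 by (simp add: frac_less2)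
      then have "filterlim (\<lambda>q. real q powr ((1 + u) / t - (1 + u) / t')) at_top sequentially"
        by real_asymp
      then have "\<forall>\<^sub>F q in sequentially. 1 / c \<le> real q powr ((1 + u) / t - (1 + u) / t')"
        by (simp add: filterlim_at_top)
      then obtain R2 where R2: "\<And>q. R2 \<le> q \<Longrightarrow> 1 / c \<le> real q powr ((1 + u) / t - (1 + u) / t')"
        by (auto simp: eventually_sequentially)
      define \<sigma> where "\<sigma> = (S + u) / 2"
      have \<sigma>: "S < \<sigma>" "\<sigma> < u" using Su by (auto simp: \<sigma>_def)
      have "(\<lambda>j. S + 1 / real (Suc j)) \<longlonglongrightarrow> S" by real_asymp
      then have ev1: "\<forall>\<^sub>F j in sequentially. S + 1 / real (Suc j) < \<sigma>"
        using \<sigma>(1) by (rule order_tendstoD)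
      have "(\<lambda>j. r j powr (u - \<sigma>)) \<longlonglongrightarrow> 0"
        using tendsto_zero_powrI[OF r_lim tendsto_const] \<sigma>(2) r0 by (simp add: always_eventually less_imp_le)
      then have ev2: "\<forall>\<^sub>F j in sequentially. r j powr (u - \<sigma>) < 1 / 2"
        by (rule order_tendstoD) simp
      obtain j where j: "max R (max R1 R2) \<le> j" "S + 1 / real (Suc j) < \<sigma>" "r j powr (u - \<sigma>) < 1 / 2"
        using eventually_conj[OF eventually_ge_at_top eventually_conj[OF ev1 ev2], of "max R (max R1 R2)"]
        unfolding eventually_sequentially by blast
      have "j < q j" using q[of j] less_exp[of j] by linarith
      then have qR: "R \<le> q j" "R1 \<le> q j" "R2 \<le> q j" using j(1) by auto
      have rj: "r j \<le> 1" using r_pow[of j] power_le_one[of "1/2::real" j] by simp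

      \<comment> \<open>The step of \<open>q j\<close> extends beyond \<open>2 * q j\<close>, because \<open>S < u\<close>.\<close>
      have "real (q j) * r j powr u = real (q j) * r j powr \<sigma> * r j powr (u - \<sigma>)"
        by (simp flip: powr_add)
      also have "\<dots> \<le> real (q j) * r j powr (S + 1 / real (Suc j)) * r j powr (u - \<sigma>)"
        using j(2) r0[of j] rj by (intro mult_right_mono mult_left_mono powr_mono') auto
      also have "\<dots> \<le> 1 * r j powr (u - \<sigma>)"
        using qr[of j] by (intro mult_right_mono) auto
      also have "\<dots> < 1 / 2" using j(3) by simp
      finally have "2 * real (q j) < r j powr - u"
        using r0[of j] by (simp add: powr_minus_divide field_simps)
      then have "2 * q j \<le> N j" using N_ge[of j] by linarith
      then have \<phi>q: "r j \<le> \<phi> (2 * q j)" by (rule r_le_\<phi>)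

      \<comment> \<open>The type bounds \<open>\<bar>\<alpha> - p j / q j\<bar>\<close>, and so \<open>r j\<close>, from below; the slack between \<open>t\<close> and
        \<open>t'\<close> absorbs the constant \<open>c\<close>.\<close>
      have qpos: "real (q j) > 0" using q1[of j] by simp
      define \<epsilon> where "\<epsilon> = \<bar>\<alpha> - real_of_int (p j) / real (q j)\<bar>"
      have q\<epsilon>: "\<bar>real (q j) * \<alpha> - real_of_int (p j)\<bar> = real (q j) * \<epsilon>"
        using qpos by (simp add: \<epsilon>_def abs_mult_pos' right_diff_distrib)
      have "c \<le> real (q j) powr ((1 + u) / t' - 1) * (real (q j) * \<epsilon>)"
        using order_trans[OF R1[OF qR(2)] mult_left_mono[OF dist_nearest_int_le[of "real (q j) * \<alpha>" "p j"]]]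
        by (simp add: q\<epsilon>)
      also have "\<dots> = real (q j) powr ((1 + u) / t') * \<epsilon>"
        using qpos by (simp add: powr_diff)
      finally have 1: "c \<le> real (q j) powr ((1 + u) / t') * \<epsilon>" .
      have "1 \<le> real (q j) powr ((1 + u) / t - (1 + u) / t') * c"
        using R2[OF qR(3)] c by (simp add: field_simps)
      also have "\<dots> \<le> real (q j) powr ((1 + u) / t - (1 + u) / t') * (real (q j) powr ((1 + u) / t') * \<epsilon>)"
        using 1 by (intro mult_left_mono) auto
      also have "\<dots> = real (q j) powr ((1 + u) / t) * \<epsilon>"
        by (simp add: mult.assoc[symmetric] powr_add[symmetric])
      finally have "real (q j) powr (- ((1 + u) / t)) \<le> \<epsilon>"
        using qpos by (simp add: powr_minus_divide field_simps)
      then have "(real (q j) powr (- ((1 + u) / t))) powr (1 / (1 + u)) \<le> r j"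
        unfolding r \<epsilon>_def[symmetric] using u0 by (intro powr_mono2) auto
      then have "real (q j) powr (- 1 / t) \<le> r j"
        using u0 by (simp add: powr_powr)
      then show "\<exists>q p. R \<le> q \<and> coprime p (int q) \<and> \<bar>\<alpha> - real_of_int p / real q\<bar> < 1 / real q ^ 2
          \<and> real q powr (- 1 / t) \<le> \<phi> (2 * q)"
        using qR(1) cop[of j] approx[of j] \<phi>q by (intro exI[of _ "q j"] exI[of _ "p j"]) auto
    qed
  qed

  ultimately have "hausdorff_dim ?E = max (ereal l) (ereal S)"
    by (intro antisym) (auto simp: ereal_max)
  then show ?thesis
    using decreasing_to_zero_\<phi> lower_order_\<phi> upper_order_\<phi> assms(3) Su
    unfolding S[symmetric] by (intro exI[of _ \<phi>]) simp
qed

end
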